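(* Let $\mathcal{A}$ be a separable nonunital $C^*$-algebra, $K$ an essential ideal in $\mathcal{A}$, and $\pi$ the canonical projection of $M(K)$ onto $M(K)/K$ (whose restriction to $\mathcal{A}$ is the canonical projection $\mathcal{A}\to\mathcal{A}/K$). Let $S$ be a closed semiregular operator on $\mathcal{A}$ such that its restriction $S|_K$ to $K$ is regular. If $$\bigl(Z(\mathcal{A}/K)\cap \pi(D(S))\bigr)\,\mathcal{A}/K \quad\text{is total in } \mathcal{A}/K,$$ where $Z(\mathcal{A}/K)$ is the centre of $\mathcal{A}/K$, then $S^{**}$ is regular.
   Context: $M(\cdot)$ denotes the multiplier algebra. Since $K$ is an essential ideal in $\mathcal{A}$, it is essential in $M(\mathcal{A})$, and one identifies $K\subseteq\mathcal{A}\subseteq M(\mathcal{A})\subseteq M(K)$. A $C^*$-algebra $\mathcal{B}$ is regarded as a (right) Hilbert $\mathcal{B}$-module over itself with inner product $\langle a,b\rangle=a^*b$. An operator $T$ on $\mathcal{B}$ is a linear map with domain $D(T)\subseteq \mathcal{B}$ and values in $\mathcal{B}$; if $T$ is densely defined, its adjoint $T^*$ has domain $D(T^* )=\{a\in\mathcal{B}:\exists\, b\in\mathcal{B},\ \langle a,Tx\rangle=\langle b,x\rangle\ \forall x\in D(T)\}$ and $T^*a=b$. $T$ is closed (closable) if its graph is closed (the closure of its graph is a graph). $T$ is semiregular if (a) $D(T)$ is a dense right ideal of $\mathcal{B}$ (i.e. a dense submodule), (b) $T$ is closable, (c) $T^*$ is densely defined. $T$ is regular if it is closed and densely defined, $T^*$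 is densely defined, and the range of $I+T^*T$ is dense in $\mathcal{B}$. The restriction $S|_K$ is the operator on $K$ (regarded as a Hilbert $K$-module) with domain $D(S)\cap K$, acting as $S$; for $S$ closed semiregular it takes values in $K$. A subset (here the set of products $xy$ with $x\in Z(\mathcal{A}/K)\cap \pi(D(S))$, $y\in\mathcal{A}/K$) is total if its linear span is norm dense. *)

theory Defs
  imports "HOL-Analysis.Analysis" "HOL-Library.Set_Algebras"
begin

section \<open>C*-algebras, not assumed unital\<close>

class cstar_algebra = real_normed_algebra + banach +
  fixes scaleC :: "complex \<Rightarrow> 'a \<Rightarrow> 'a"  (infixr "*\<^sub>C" 75)
    and star :: "'a \<Rightarrow> 'a"
  assumes scaleC_add_right: "c *\<^sub>C (x + y) = c *\<^sub>C x + c *\<^sub>C y"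
    and scaleC_add_left: "(c + d) *\<^sub>C x = c *\<^sub>C x + d *\<^sub>C x"
    and scaleC_scaleC: "c *\<^sub>C (d *\<^sub>C x) = (c * d) *\<^sub>C x"
    and scaleC_of_real: "complex_of_real r *\<^sub>C x = r *\<^sub>R x"
    and norm_scaleC: "norm (c *\<^sub>C x) = cmod c * norm x"
    and mult_scaleC_left: "(c *\<^sub>C x) * y = c *\<^sub>C (x * y)"
    and mult_scaleC_right: "x * (c *\<^sub>C y) = c *\<^sub>C (x * y)"
    and star_star: "star (star x) = x"
    and star_add: "star (x + y) = star x + star y"
    and star_scaleC: "star (c *\<^sub>C x) = cnj c *\<^sub>C star x"
    and star_mult: "star (x * y) = star y * star x"
    and norm_star_mult: "norm (star x * x) = (norm x)\<^sup>2"

global_interpretation complex_vector: vector_space "scaleC :: complex \<Rightarrow> 'a \<Rightarrow> 'a::cstar_algebra"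
  defines csubspace_raw_def: csubspace = complex_vector.subspace
proof unfold_locales
  show "1 *\<^sub>C x = x" for x :: 'a
    using scaleC_of_real[of 1 x] by simp
qed (simp_all add: scaleC_add_right scaleC_add_left scaleC_scaleC)

definition unital_algebra :: "'a::cstar_algebra itself \<Rightarrow> bool" where
  "unital_algebra _ \<longleftrightarrow> (\<exists>e::'a. \<forall>x. e * x = x \<and> x * e = x)"

definition closed_ideal :: "'a::cstar_algebra set \<Rightarrow> bool" where
  "closed_ideal J \<longleftrightarrow> csubspace J \<and> closed J \<and> (\<forall>x\<in>J. \<forall>a. a * x \<in> J \<and> x * a \<in> J)"

definition essential_ideal :: "'a::cstar_algebra set \<Rightarrow> bool" where
  "essential_ideal K \<longleftrightarrow>
     closed_ideal K \<and> (\<forall>J. closed_ideal J \<and> J \<noteq> {0} \<longrightarrow> K \<inter> J \<noteq> {0})"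

section \<open>Unbounded operators\<close>

text \<open>
  An operator is represented by its graph, so that \<^term>\<open>Domain T\<close> is its domain and inclusion
  of graphs is extension of operators.  The first argument \<open>B\<close> of the notions below is the
  C*-algebra the operator acts on, viewed as a Hilbert module over itself with inner product
  \<open>\<langle>a, b\<rangle> = a\<^sup>* b\<close>; it is either the whole type or a closed ideal.  Closedness of graphs may be
  taken in the ambient type because \<open>B\<close> is closed.
\<close>

definition operator_on :: "'a::cstar_algebra set \<Rightarrow> ('a \<times> 'a) set \<Rightarrow> bool" where
  "operator_on B T \<longleftrightarrow> T \<subseteq> B \<times> B \<and> single_valued T \<and> (0, 0) \<in> T \<and>
     (\<forall>(x, y)\<in>T. \<forall>(x', y')\<in>T. (x + x', y + y') \<in> T) \<and>
     (\<forall>c. \<forall>(x, y)\<in>T. (c *\<^sub>C x, c *\<^sub>C y) \<in> T)"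

definition dense_in :: "'a::cstar_algebra set \<Rightarrow> 'a set \<Rightarrow> bool" where
  "dense_in B D \<longleftrightarrow> D \<subseteq> B \<and> B \<subseteq> closure D"

definition adjoint_on :: "'a::cstar_algebra set \<Rightarrow> ('a \<times> 'a) set \<Rightarrow> ('a \<times> 'a) set" where
  "adjoint_on B T = {(a, b). a \<in> B \<and> b \<in> B \<and> (\<forall>(x, y)\<in>T. star a * y = star b * x)}"

lemma single_valued_adjoint_on:
  fixes B :: "'a::cstar_algebra set"
  assumes "csubspace B" "dense_in B (Domain T)"
  shows "single_valued (adjoint_on B T)"
proof (rule single_valuedI)
  fix a b c assume ab: "(a, b) \<in> adjoint_on B T" and ac: "(a, c) \<in> adjoint_on B T"
  have 0: "star x - star y = star (x - y)" for x y :: 'a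
    using star_add[of "x - y" y] by simp
  have "star (b - c) * x = 0" if "x \<in> Domain T" for x
    using that ab ac by (fastforce simp: adjoint_on_def 0[symmetric] left_diff_distrib)
  then have "Domain T \<subseteq> {x. star (b - c) * x = 0}" by blast
  moreover have "closed {x. star (b - c) * x = 0}"
    by (intro closed_Collect_eq continuous_intros)
  ultimately have "B \<subseteq> {x. star (b - c) * x = 0}"
    using assms(2) closure_minimal unfolding dense_in_def by blast
  moreover have "b - c \<in> B"
    using ab ac assms(1) by (auto simp: adjoint_on_def intro: complex_vector.subspace_diff)
  ultimately have "star (b - c) * (b - c) = 0" by blast
  then show "b = c" using norm_star_mult[of "b - c"] by simp
qed

definition semiregular_on :: "'a::cstar_algebra set \<Rightarrow> ('a \<times> 'a) set \<Rightarrow> bool" where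
  "semiregular_on B T \<longleftrightarrow> operator_on B T \<and>
     dense_in B (Domain T) \<and> (\<forall>x\<in>Domain T. \<forall>b\<in>B. x * b \<in> Domain T) \<and>
     single_valued (closure T) \<and>
     dense_in B (Domain (adjoint_on B T))"

definition regular_on :: "'a::cstar_algebra set \<Rightarrow> ('a \<times> 'a) set \<Rightarrow> bool" where
  "regular_on B T \<longleftrightarrow> operator_on B T \<and>
     closed T \<and> dense_in B (Domain T) \<and>
     dense_in B (Domain (adjoint_on B T)) \<and>
     dense_in B {x + z | x z. (x, z) \<in> T O adjoint_on B T}"

definition restrict_operator :: "('a \<times> 'a) set \<Rightarrow> 'a set \<Rightarrow> ('a \<times> 'a) set" where
  "restrict_operator T K = {(x, y) \<in> T. x \<in> K}"

section \<open>The quotient by a closed ideal\<close>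

text \<open>
  Since \<open>K\<close> varies, the quotient cannot be a type: its elements are the cosets of \<open>K\<close>.  The
  operations are defined as unions over representatives; the lemmas below show that, for an ideal,
  they do not depend on these.
\<close>

definition quot_proj :: "'a::cstar_algebra set \<Rightarrow> 'a \<Rightarrow> 'a set" where
  "quot_proj K a = a +o K"

definition quot_add :: "'a::cstar_algebra set \<Rightarrow> 'a set \<Rightarrow> 'a set \<Rightarrow> 'a set" where
  "quot_add K X Y = (\<Union>x\<in>X. \<Union>y\<in>Y. quot_proj K (x + y))"

definition quot_diff :: "'a::cstar_algebra set \<Rightarrow> 'a set \<Rightarrow> 'a set \<Rightarrow> 'a set" where
  "quot_diff K X Y = (\<Union>x\<in>X. \<Union>y\<in>Y. quot_proj K (x - y))"

definition quot_mult :: "'a::cstar_algebra set \<Rightarrow> 'a set \<Rightarrow> 'a set \<Rightarrow> 'a set" where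
  "quot_mult K X Y = (\<Union>x\<in>X. \<Union>y\<in>Y. quot_proj K (x * y))"

definition quot_scaleC :: "'a::cstar_algebra set \<Rightarrow> complex \<Rightarrow> 'a set \<Rightarrow> 'a set" where
  "quot_scaleC K c X = (\<Union>x\<in>X. quot_proj K (c *\<^sub>C x))"

definition quot_norm :: "'a::cstar_algebra set \<Rightarrow> real" where
  "quot_norm X = (INF x\<in>X. norm x)"

lemma quot_proj_self: "closed_ideal K \<Longrightarrow> a \<in> quot_proj K a"
  using complex_vector.subspace_0
  by (force simp: closed_ideal_def quot_proj_def elt_set_plus_def)

lemma quot_proj_eq_iff:
  assumes "closed_ideal K"
  shows "quot_proj K a = quot_proj K b \<longleftrightarrow> a - b \<in> K"
proof
  assume "quot_proj K a = quot_proj K b"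
  then have "a \<in> quot_proj K b" using quot_proj_self[OF assms, of a] by simp
  then show "a - b \<in> K" by (auto simp: quot_proj_def elt_set_plus_def)
next
  assume ab: "a - b \<in> K"
  have K: "csubspace K" using assms by (simp add: closed_ideal_def)
  have sub: "quot_proj K x \<subseteq> quot_proj K y" if "x - y \<in> K" for x y
  proof
    fix z assume "z \<in> quot_proj K x"
    then obtain k where "k \<in> K" "z = x + k" by (auto simp: quot_proj_def elt_set_plus_def)
    then have "z = y + ((x - y) + k)" "(x - y) + k \<in> K"
      using complex_vector.subspace_add[OF K that] by auto
    then show "z \<in> quot_proj K y" unfolding quot_proj_def elt_set_plus_def by blast
  qed
  have "b - a \<in> K" using complex_vector.subspace_neg[OF K ab] by simp
  then show "quot_proj K a = quot_proj K b" using sub ab by blast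
qed

lemma quot_proj_mem:
  assumes "closed_ideal K" "x \<in> quot_proj K a"
  shows "x - a \<in> K"
  using assms by (auto simp: quot_proj_def elt_set_plus_def)

lemma
  assumes K: "closed_ideal K"
  shows quot_add_proj: "quot_add K (quot_proj K a) (quot_proj K b) = quot_proj K (a + b)"
    and quot_diff_proj: "quot_diff K (quot_proj K a) (quot_proj K b) = quot_proj K (a - b)"
    and quot_mult_proj: "quot_mult K (quot_proj K a) (quot_proj K b) = quot_proj K (a * b)"
    and quot_scaleC_proj: "quot_scaleC K c (quot_proj K a) = quot_proj K (c *\<^sub>C a)"
proof -
  have S: "csubspace K" and I: "\<And>x y. x \<in> K \<Longrightarrow> y * x \<in> K \<and> x * y \<in> K"
    using K by (auto simp: closed_ideal_def)
  have add: "quot_proj K (x + y) = quot_proj K (a + b)"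
    and diff: "quot_proj K (x - y) = quot_proj K (a - b)"
    and mult: "quot_proj K (x * y) = quot_proj K (a * b)"
    if "x \<in> quot_proj K a" "y \<in> quot_proj K b" for x y
  proof -
    have xy: "x - a \<in> K" "y - b \<in> K" using that quot_proj_mem[OF K] by auto
    have "(x - a) + (y - b) \<in> K" "(x - a) - (y - b) \<in> K" "(x - a) * y + a * (y - b) \<in> K"
      using xy I S by (auto intro: complex_vector.subspace_add complex_vector.subspace_diff)
    moreover have "(x - a) + (y - b) = (x + y) - (a + b)"
      "(x - a) - (y - b) = (x - y) - (a - b)"
      "(x - a) * y + a * (y - b) = x * y - a * b" by (simp_all add: algebra_simps)
    ultimately show "quot_proj K (x + y) = quot_proj K (a + b)"
      "quot_proj K (x - y) = quot_proj K (a - b)"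
      "quot_proj K (x * y) = quot_proj K (a * b)"
      by (auto simp: quot_proj_eq_iff[OF K])
  qed
  have scale: "quot_proj K (c *\<^sub>C x) = quot_proj K (c *\<^sub>C a)" if "x \<in> quot_proj K a" for x
    using complex_vector.subspace_scale[OF S quot_proj_mem[OF K that], of c]
    by (simp add: quot_proj_eq_iff[OF K] complex_vector.scale_right_diff_distrib)
  note ne = quot_proj_self[OF K]
  show "quot_add K (quot_proj K a) (quot_proj K b) = quot_proj K (a + b)"
    unfolding quot_add_def using add ne by blast
  show "quot_diff K (quot_proj K a) (quot_proj K b) = quot_proj K (a - b)"
    unfolding quot_diff_def using diff ne by blast
  show "quot_mult K (quot_proj K a) (quot_proj K b) = quot_proj K (a * b)"
    unfolding quot_mult_def using mult ne by blast
  show "quot_scaleC K c (quot_proj K a) = quot_proj K (c *\<^sub>C a)"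
    unfolding quot_scaleC_def using scale ne by blast
qed

definition quot_centre :: "'a::cstar_algebra set \<Rightarrow> 'a set set" where
  "quot_centre K =
     {X \<in> range (quot_proj K). \<forall>Y\<in>range (quot_proj K). quot_mult K X Y = quot_mult K Y X}"

inductive_set quot_span :: "'a::cstar_algebra set \<Rightarrow> 'a set set \<Rightarrow> 'a set set"
  for K :: "'a set" and G :: "'a set set" where
  zero: "quot_proj K 0 \<in> quot_span K G"
| add_scaleC: "X \<in> G \<Longrightarrow> Y \<in> quot_span K G \<Longrightarrow> quot_add K (quot_scaleC K c X) Y \<in> quot_span K G"

definition quot_total :: "'a::cstar_algebra set \<Rightarrow> 'a set set \<Rightarrow> bool" where
  "quot_total K G \<longleftrightarrow> G \<subseteq> range (quot_proj K) \<and>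
     (\<forall>X\<in>range (quot_proj K). \<forall>e>0. \<exists>Y\<in>quot_span K G. quot_norm (quot_diff K X Y) < e)"

end

theory Submission
  imports Defs
begin

text \<open>
  Write \<open>N\<close> for the range of \<open>I + S\<^sup>* S\<^sup>*\<^sup>*\<close>. It is the set of all \<open>u\<close> for which \<open>(u, 0)\<close> lies in
  the orthogonal sum of the graph of \<open>S\<^sup>*\<^sup>*\<close> and the flipped graph of \<open>S\<^sup>*\<close>, hence a closed right
  ideal, and it contains \<open>K\<close> because the restriction to \<open>K\<close> is regular. Let \<open>a\<close> be in the domain of
  \<open>S\<close> and central modulo \<open>K\<close>, and let \<open>b = S a\<close>. For \<open>w\<close> in the domain of \<open>S\<^sup>*\<close> close to \<open>b x\<close>,
  \<open>(a x + S\<^sup>* w) a\<^sup>*\<close> equals \<open>a\<^sup>* (a x + S\<^sup>* w) = a\<^sup>* a x + b\<^sup>* w\<close> modulo \<open>K\<close>; so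
  \<open>(a\<^sup>* a + b\<^sup>* b) x \<in> N\<close> for all \<open>x\<close>. Since \<open>a\<^sup>* a \<le> a\<^sup>* a + b\<^sup>* b\<close>, this gives first \<open>a\<^sup>* \<in> N\<close>
  and then, by centrality, \<open>a \<in> N\<close>. By totality, \<open>N\<close> is everything.
\<close>

subsection \<open>The involution\<close>

lemma star_zero [simp]: "star (0::'a::cstar_algebra) = 0"
  using star_add[of "0::'a" 0] by simp

lemma star_minus: "star (- x) = - star (x::'a::cstar_algebra)"
  using star_add[of x "- x"] by (simp add: minus_unique)

lemma star_diff: "star (x - y) = star x - star (y::'a::cstar_algebra)"
  using star_add[of x "- y"] by (simp add: star_minus)

lemma star_scaleR: "star (r *\<^sub>R x) = r *\<^sub>R star (x::'a::cstar_algebra)"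
  using star_scaleC[of "complex_of_real r" x] by (simp add: scaleC_of_real)

lemma norm_star [simp]: "norm (star x) = norm (x::'a::cstar_algebra)"
proof -
  have le: "norm y \<le> norm (star y)" for y :: 'a
  proof (cases "y = 0")
    case False
    have "norm y * norm y \<le> norm (star y) * norm y"
      using norm_mult_ineq[of "star y" y] norm_star_mult[of y] by (simp add: power2_eq_square)
    with False show ?thesis by simp
  qed simp
  show ?thesis using le[of x] le[of "star x"] by (simp add: star_star)
qed

lemma bounded_linear_star: "bounded_linear (star :: 'a::cstar_algebra \<Rightarrow> 'a)"
  by (rule bounded_linear_intro[where K = 1]) (simp_all add: star_add star_scaleR)

lemmas tendsto_star [tendsto_intros] = bounded_linear.tendsto[OF bounded_linear_star]

lemmas continuous_on_star [continuous_intros] = bounded_linear.continuous_on[OF bounded_linear_star]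

lemma star_mult_eq_0_iff: "star x * x = 0 \<longleftrightarrow> x = (0::'a::cstar_algebra)"
  using norm_star_mult[of x] by auto

lemma mult_star_eq_0_iff: "x * star x = 0 \<longleftrightarrow> x = (0::'a::cstar_algebra)"
  using star_mult_eq_0_iff[of "star x"] norm_star[of x] by (metis norm_eq_zero star_star)

lemma bounded_linear_scaleC: "bounded_linear (scaleC c :: 'a::cstar_algebra \<Rightarrow> 'a)"
proof (rule bounded_linear_intro[where K = "cmod c"])
  show "c *\<^sub>C (r *\<^sub>R x) = r *\<^sub>R (c *\<^sub>C x)" for r and x :: 'a
    by (simp flip: scaleC_of_real add: scaleC_scaleC mult.commute)
qed (simp_all add: scaleC_add_right norm_scaleC mult.commute)

lemma csubspace_imp_subspace: "csubspace M \<Longrightarrow> subspace (M :: 'a::cstar_algebra set)"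
  by (auto simp: subspace_def complex_vector.subspace_0 complex_vector.subspace_add
      complex_vector.subspace_scale simp flip: scaleC_of_real)


subsection \<open>The multiplier algebra\<close>

text \<open>
  \<^class>\<open>monoid_mult\<close> rather than \<^class>\<open>ring_1\<close>: the multiplier algebra of a trivial algebra is trivial.
\<close>

class unital_cstar_algebra = cstar_algebra + monoid_mult

text \<open>Multipliers are encoded as adjointable operators on the Hilbert module
  \<open>'a\<close>. They supply the unit on which the treatment of positivity rests.\<close>

typedef (overloaded) 'a multiplier =
  "{(f :: 'a::cstar_algebra \<Rightarrow>\<^sub>L 'a, g :: 'a \<Rightarrow>\<^sub>L 'a). \<forall>x y. star (f x) * y = star x * g y}"
  by (rule exI[of _ 0]) (simp add: zero_prod_def)

definition mapply :: "'a::cstar_algebra multiplier \<Rightarrow> 'a \<Rightarrow>\<^sub>L 'a" where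
  "mapply u = fst (Rep_multiplier u)"

definition madj :: "'a::cstar_algebra multiplier \<Rightarrow> 'a \<Rightarrow>\<^sub>L 'a" where
  "madj u = snd (Rep_multiplier u)"

lemma star_mapply_mult: "star (mapply u x) * y = star x * madj u y"
  using Rep_multiplier[of u] by (auto simp: mapply_def madj_def)

lemma star_madj_mult: "star (madj u x) * y = star x * mapply u y"
  using arg_cong[OF star_mapply_mult[of u y x, symmetric], of star] by (simp add: star_mult star_star)

text \<open>Apply the C*-identity to \<open>star (f x) * f x = star x * g (f x)\<close>. Used in
  both directions, this makes an operator and its adjoint equally large.\<close>

lemma adjointable_norm_le:
  fixes f g :: "'a::cstar_algebra \<Rightarrow>\<^sub>L 'a"
  assumes "\<And>x y. star (f x) * y = star x * g y"
  shows "(norm f)\<^sup>2 \<le> norm (g o\<^sub>L f)" "norm f \<le> norm g"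
proof -
  have "norm (f x) \<le> sqrt (norm (g o\<^sub>L f)) * norm x" for x
  proof (rule power2_le_imp_le)
    have "(norm (f x))\<^sup>2 = norm (star x * (g o\<^sub>L f) x)"
      by (simp flip: norm_star_mult add: assms[of x "f x"])
    also have "\<dots> \<le> norm x * (norm (g o\<^sub>L f) * norm x)"
      by (rule order_trans[OF norm_mult_ineq])
        (use norm_blinfun[of "g o\<^sub>L f" x] in \<open>simp add: mult_left_mono\<close>)
    finally show "(norm (f x))\<^sup>2 \<le> (sqrt (norm (g o\<^sub>L f)) * norm x)\<^sup>2"
      by (simp add: power_mult_distrib power2_eq_square ac_simps)
  qed simp
  then have "norm f \<le> sqrt (norm (g o\<^sub>L f))"
    by (intro norm_blinfun_bound) auto
  then show *: "(norm f)\<^sup>2 \<le> norm (g o\<^sub>L f)"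
    using power_mono[of "norm f" "sqrt (norm (g o\<^sub>L f))" 2] by simp
  then have "norm f * norm f \<le> norm g * norm f"
    using norm_blinfun_compose[of g f] by (simp add: power2_eq_square)
  then show "norm f \<le> norm g"
    by (cases "f = 0") auto
qed

lemma norm_madj: "norm (madj u) = norm (mapply u)"
  by (intro antisym adjointable_norm_le(2) star_madj_mult star_mapply_mult)

lemma norm_madj_mapply: "norm (madj u o\<^sub>L mapply u) = (norm (mapply u))\<^sup>2"
  using adjointable_norm_le(1)[of "mapply u" "madj u"] norm_blinfun_compose[of "madj u" "mapply u"]
  by (simp add: star_mapply_mult norm_madj power2_eq_square)

lemma multiplier_eqI:
  assumes "mapply u = mapply v"
  shows "u = v"
proof -
  have "madj u y - madj v y = 0" for y
  proof -
    have "star (madj u y - madj v y) * (madj u y - madj v y)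
      = star (mapply u (madj u y - madj v y)) * y - star (mapply v (madj u y - madj v y)) * y"
      by (simp add: star_mapply_mult right_diff_distrib)
    then show ?thesis using assms by (simp add: star_mult_eq_0_iff)
  qed
  then have "madj u = madj v" by (intro blinfun_eqI) simp
  with assms show ?thesis
    by (simp add: mapply_def madj_def prod_eq_iff flip: Rep_multiplier_inject)
qed

lemma mapply_Abs:
  fixes f g :: "'a::cstar_algebra \<Rightarrow>\<^sub>L 'a"
  assumes "\<And>x y. star (f x) * y = star x * g y"
  shows "mapply (Abs_multiplier (f, g)) = f" "madj (Abs_multiplier (f, g)) = g"
  using assms by (simp_all add: mapply_def madj_def Abs_multiplier_inverse)

instantiation multiplier :: (cstar_algebra) real_normed_vector
begin

definition "0 = Abs_multiplier (0, 0)"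
definition "u + v = Abs_multiplier (mapply u + mapply v, madj u + madj v)"
definition "u - v = Abs_multiplier (mapply u - mapply v, madj u - madj v)"
definition "- u = Abs_multiplier (- mapply u, - madj u)"
definition "r *\<^sub>R u = Abs_multiplier (r *\<^sub>R mapply u, r *\<^sub>R madj u)"
definition "norm u = norm (mapply u)" for u :: "'a multiplier"
definition "sgn u = inverse (norm u) *\<^sub>R u" for u :: "'a multiplier"
definition "dist u v = norm (u - v)" for u v :: "'a multiplier"
definition "(uniformity :: ('a multiplier \<times> 'a multiplier) filter) =
  (INF e\<in>{0 <..}. principal {(x, y). dist x y < e})"
definition "open (U :: 'a multiplier set) =
  (\<forall>x\<in>U. \<forall>\<^sub>F (x', y) in uniformity. x' = x \<longrightarrow> y \<in> U)"

lemma mapply_vector [simp]: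
  "mapply 0 = 0"
  "mapply (u + v) = mapply u + mapply v"
  "mapply (u - v) = mapply u - mapply v"
  "mapply (- u) = - mapply u"
  "mapply (r *\<^sub>R u) = r *\<^sub>R mapply u"
  unfolding zero_multiplier_def plus_multiplier_def minus_multiplier_def uminus_multiplier_def
    scaleR_multiplier_def
  by (rule mapply_Abs; simp add: blinfun.bilinear_simps star_add star_diff star_minus star_scaleR
      distrib_left distrib_right left_diff_distrib right_diff_distrib star_mapply_mult)+

lemma madj_minus: "madj (u - v) = madj u - madj v"
  unfolding minus_multiplier_def
  by (rule mapply_Abs; simp add: blinfun.bilinear_simps star_diff left_diff_distrib
      right_diff_distrib star_mapply_mult)

instance
  by standard (auto intro: multiplier_eqI norm_triangle_ineq
      simp: norm_multiplier_def sgn_multiplier_def dist_multiplier_def uniformity_multiplier_def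
        open_multiplier_def scaleR_add_left scaleR_add_right)

end

instance multiplier :: (cstar_algebra) banach
proof
  fix X :: "nat \<Rightarrow> 'a multiplier"
  assume X: "Cauchy X"
  have "Cauchy (\<lambda>n. mapply (X n))" "Cauchy (\<lambda>n. madj (X n))"
    using X unfolding Cauchy_def
    by (simp_all add: dist_norm norm_multiplier_def madj_minus[symmetric] norm_madj)
  then obtain f g where f: "(\<lambda>n. mapply (X n)) \<longlonglongrightarrow> f" and g: "(\<lambda>n. madj (X n)) \<longlonglongrightarrow> g"
    by (meson Cauchy_convergent convergent_def)
  have "star (f x) * y = star x * g y" for x y
  proof (rule LIMSEQ_unique)
    show "(\<lambda>n. star (mapply (X n) x) * y) \<longlonglongrightarrow> star (f x) * y"
      by (intro tendsto_intros f)
    show "(\<lambda>n. star (mapply (X n) x) * y) \<longlonglongrightarrow> star x * g y"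
      unfolding star_mapply_mult by (intro tendsto_intros g)
  qed
  then have "mapply (Abs_multiplier (f, g)) = f" by (rule mapply_Abs)
  with f have "X \<longlonglongrightarrow> Abs_multiplier (f, g)"
    unfolding tendsto_iff by (simp add: dist_norm norm_multiplier_def)
  then show "convergent X" by (auto simp: convergent_def)
qed

text \<open>The type of bounded maps gives only real linearity; the adjoint relation gives the
  complex one, as the inner product is nondegenerate.\<close>

lemma mapply_scaleC: "mapply u (c *\<^sub>C x) = c *\<^sub>C mapply u x"
proof -
  let ?d = "mapply u (c *\<^sub>C x) - c *\<^sub>C mapply u x"
  have "star ?d * y = 0" for y
    by (simp add: star_diff star_scaleC left_diff_distrib mult_scaleC_left star_mapply_mult)
  then show ?thesis by (metis eq_iff_diff_eq_0 star_mult_eq_0_iff)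
qed

lemma madj_scaleC: "madj u (c *\<^sub>C x) = c *\<^sub>C madj u x"
proof -
  let ?d = "madj u (c *\<^sub>C x) - c *\<^sub>C madj u x"
  have "star ?d * y = 0" for y
    by (simp add: star_diff star_scaleC left_diff_distrib mult_scaleC_left star_madj_mult)
  then show ?thesis by (metis eq_iff_diff_eq_0 star_mult_eq_0_iff)
qed

definition blinfun_scaleC :: "complex \<Rightarrow> 'a \<Rightarrow>\<^sub>L 'a::cstar_algebra" where
  "blinfun_scaleC c = Blinfun (scaleC c)"

lemma blinfun_scaleC_apply [simp]: "blinfun_scaleC c x = c *\<^sub>C x"
  by (simp add: blinfun_scaleC_def bounded_linear_Blinfun_apply bounded_linear_scaleC)

instantiation multiplier :: (cstar_algebra) unital_cstar_algebra
begin

definition "1 = Abs_multiplier (id_blinfun, id_blinfun)"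
definition "u * v = Abs_multiplier (mapply u o\<^sub>L mapply v, madj v o\<^sub>L madj u)"
definition "star u = Abs_multiplier (madj u, mapply u)"
definition "c *\<^sub>C u = Abs_multiplier (blinfun_scaleC c o\<^sub>L mapply u, blinfun_scaleC (cnj c) o\<^sub>L madj u)"

lemma mapply_algebra [simp]:
  "mapply 1 = id_blinfun"
  "mapply (u * v) = mapply u o\<^sub>L mapply v"
  "mapply (star u) = madj u"
  "mapply (c *\<^sub>C u) = blinfun_scaleC c o\<^sub>L mapply u"
  unfolding one_multiplier_def times_multiplier_def star_multiplier_def scaleC_multiplier_def
  by (rule mapply_Abs; simp add: star_mapply_mult star_madj_mult star_scaleC mult_scaleC_left
      mult_scaleC_right)+

lemma madj_algebra [simp]:
  "madj (u + v) = madj u + madj v"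
  "madj (u * v) = madj v o\<^sub>L madj u"
  "madj (star u) = mapply u"
  "madj (c *\<^sub>C u) = blinfun_scaleC (cnj c) o\<^sub>L madj u"
  unfolding plus_multiplier_def times_multiplier_def star_multiplier_def scaleC_multiplier_def
  by (rule mapply_Abs; simp add: star_mapply_mult star_madj_mult star_scaleC mult_scaleC_left
      mult_scaleC_right star_add distrib_left distrib_right blinfun.bilinear_simps)+

instance
proof
  fix u v w :: "'a multiplier" and c d :: complex and r :: real
  show "(u * v) * w = u * (v * w)" "1 * u = u" "u * 1 = u"
    "(u + v) * w = u * w + v * w" "u * (v + w) = u * v + u * w"
    "(r *\<^sub>R u) * v = r *\<^sub>R (u * v)" "u * (r *\<^sub>R v) = r *\<^sub>R (u * v)"
    "c *\<^sub>C (u + v) = c *\<^sub>C u + c *\<^sub>C v"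
    "(c + d) *\<^sub>C u = c *\<^sub>C u + d *\<^sub>C u"
    "c *\<^sub>C d *\<^sub>C u = (c * d) *\<^sub>C u"
    "complex_of_real r *\<^sub>C u = r *\<^sub>R u"
    "(c *\<^sub>C u) * v = c *\<^sub>C (u * v)"
    "u * (c *\<^sub>C v) = c *\<^sub>C (u * v)"
    "star (star u) = u" "star (u + v) = star u + star v"
    "star (c *\<^sub>C u) = cnj c *\<^sub>C star u"
    "star (u * v) = star v * star u"
    by (intro multiplier_eqI blinfun_eqI; simp add: blinfun.bilinear_simps scaleC_add_right
        scaleC_add_left scaleC_scaleC scaleC_of_real mapply_scaleC madj_scaleC)+
  show "norm (u * v) \<le> norm u * norm v"
    by (simp add: norm_multiplier_def norm_blinfun_compose)
  show "norm (star u * u) = (norm u)\<^sup>2"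
    by (simp add: norm_multiplier_def norm_madj_mapply)
  show "norm (c *\<^sub>C u) = cmod c * norm u"
  proof (rule antisym)
    have le: "norm (d *\<^sub>C v) \<le> cmod d * norm v" for d and v :: "'a multiplier"
      unfolding norm_multiplier_def
    proof (rule norm_blinfun_bound)
      show "norm (mapply (d *\<^sub>C v) x) \<le> cmod d * norm (mapply v) * norm x" for x
        using norm_blinfun[of "mapply v" x]
        by (simp add: norm_scaleC mult.assoc mult_left_mono)
    qed simp
    show "norm (c *\<^sub>C u) \<le> cmod c * norm u" by (rule le)
    show "cmod c * norm u \<le> norm (c *\<^sub>C u)"
    proof (cases "c = 0")
      case False
      have "inverse c *\<^sub>C c *\<^sub>C u = u"
        using False
        by (intro multiplier_eqI blinfun_eqI) (simp add: scaleC_scaleC complex_vector.scale_one)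
      then have "norm u \<le> cmod (inverse c) * norm (c *\<^sub>C u)"
        using le[of "inverse c" "c *\<^sub>C u"] by simp
      with False show ?thesis by (simp add: norm_divide field_simps)
    qed simp
  qed
qed

end

section \<open>Isometric embedding into the multiplier algebra\<close>

definition lmult :: "'a::cstar_algebra \<Rightarrow> 'a multiplier" where
  "lmult a = Abs_multiplier (blinfun_mult_right a, blinfun_mult_right (star a))"

lemma mapply_lmult: "mapply (lmult a) x = a * x"
  and madj_lmult: "madj (lmult a) x = star a * x"
proof -
  have "mapply (lmult a) = blinfun_mult_right a" "madj (lmult a) = blinfun_mult_right (star a)"
    unfolding lmult_def
    by (rule mapply_Abs; simp add: blinfun_mult_right.rep_eq star_mult star_star mult.assoc)+
  then show "mapply (lmult a) x = a * x" "madj (lmult a) x = star a * x"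
    by (simp_all add: blinfun_mult_right.rep_eq)
qed

lemma lmult_simps:
  "lmult (a + b) = lmult a + lmult b"
  "lmult (a - b) = lmult a - lmult b"
  "lmult (a * b) = lmult a * lmult b"
  "lmult (star a) = star (lmult a)"
  "lmult (r *\<^sub>R a) = r *\<^sub>R lmult a"
  by (intro multiplier_eqI blinfun_eqI; simp add: mapply_lmult madj_lmult algebra_simps
      blinfun.bilinear_simps)+

lemma norm_lmult: "norm (lmult a) = norm a"
proof (rule antisym)
  show "norm (lmult a) \<le> norm a"
    unfolding norm_multiplier_def
    by (rule norm_blinfun_bound) (simp_all add: mapply_lmult norm_mult_ineq)
  have "norm a * norm a = norm (mapply (lmult a) (star a))"
    using norm_star_mult[of "star a"] by (simp add: mapply_lmult star_star power2_eq_square)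
  also have "\<dots> \<le> norm (lmult a) * norm a"
    using norm_blinfun[of "mapply (lmult a)" "star a"] by (simp add: norm_multiplier_def)
  finally show "norm a \<le> norm (lmult a)"
    by (cases "a = 0") auto
qed


subsection \<open>Positive elements\<close>

lemma star_one [simp]: "star 1 = (1::'b::unital_cstar_algebra)"
  by (metis mult_1_left mult_1_right star_mult star_star)

lemma norm_one_le: "norm (1::'b::unital_cstar_algebra) \<le> 1"
proof -
  have "norm (1::'b) * norm (1::'b) = norm (1::'b) * 1"
    using norm_star_mult[of "1::'b"] by (simp add: power2_eq_square)
  then show ?thesis by (cases "norm (1::'b) = 0") auto
qed

lemma norm_scaleR_one_le: "0 \<le> t \<Longrightarrow> norm (t *\<^sub>R (1::'b::unital_cstar_algebra)) \<le> t"
  using mult_left_mono[OF norm_one_le, of t] by simp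

lemma norm_self_adjoint_square: "star h = h \<Longrightarrow> norm (h * h) = (norm (h::'b::unital_cstar_algebra))\<^sup>2"
  using norm_star_mult[of h] by simp

lemma star_power: "star (h ^ n) = star (h::'b::unital_cstar_algebra) ^ n"
  by (induction n) (simp_all add: star_mult power_commutes)

text \<open>
  For self-adjoint elements this is equivalent to the spectrum lying in \<open>[0, \<infinity>)\<close>, and it
  makes the closure of positivity under addition immediate.
\<close>

definition pos :: "'b::unital_cstar_algebra \<Rightarrow> bool" where
  "pos h \<longleftrightarrow> star h = h \<and> (\<exists>t\<ge>0. norm (t *\<^sub>R 1 - h) \<le> t)"

lemma posI: "star h = h \<Longrightarrow> norm (t *\<^sub>R 1 - h) \<le> t \<Longrightarrow> pos h"
  unfolding pos_def using norm_ge_zero order_trans by blast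

lemma pos_star: "pos h \<Longrightarrow> star h = h"
  by (simp add: pos_def)

lemma pos_add:
  assumes "pos h" "pos k"
  shows "pos (h + k)"
proof -
  obtain s t where "norm (s *\<^sub>R 1 - h) \<le> s" "norm (t *\<^sub>R 1 - k) \<le> t"
    using assms by (auto simp: pos_def)
  then have "norm ((s *\<^sub>R 1 - h) + (t *\<^sub>R 1 - k)) \<le> s + t"
    by (intro norm_triangle_le) simp
  then have "norm ((s + t) *\<^sub>R 1 - (h + k)) \<le> s + t"
    by (simp add: algebra_simps)
  then show ?thesis using assms by (auto intro: posI simp: star_add pos_star)
qed

lemma pos_scaleR:
  assumes "pos h" "0 \<le> r"
  shows "pos (r *\<^sub>R h)"
proof -
  obtain t where "norm (t *\<^sub>R 1 - h) \<le> t"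
    using assms by (auto simp: pos_def)
  then have "norm (r *\<^sub>R (t *\<^sub>R 1 - h)) \<le> r * t"
    using assms(2) by (simp add: mult_left_mono)
  then have "norm ((r * t) *\<^sub>R 1 - r *\<^sub>R h) \<le> r * t"
    by (simp add: algebra_simps)
  then show ?thesis using assms by (auto intro: posI simp: star_scaleR pos_star)
qed

lemma pos_one: "pos (1::'b::unital_cstar_algebra)"
  by (rule posI[of _ 1]) simp_all

lemma pos_zero: "pos (0::'b::unital_cstar_algebra)"
  by (rule posI[of _ 0]) simp_all

text \<open>The square root is \<open>1 - y\<close>, where \<open>y\<close> is the fixed point of the contraction \<open>y \<mapsto> (k + y\<^sup>2) / 2\<close>.\<close>

lemma sqrt_one_minus:
  fixes k :: "'b::unital_cstar_algebra"
  assumes k: "star k = k" "norm k < 1"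
  shows "\<exists>r. star r = r \<and> r * r = 1 - k \<and> (\<forall>z. z * k = k * z \<longrightarrow> z * r = r * z)"
proof -
  \<comment> \<open>Self-adjointness and commutation are closed conditions preserved by
    \<open>f\<close>, so the fixed point inherits them; the radius \<open>norm k < 1\<close> makes
    \<open>f\<close> a contraction.\<close>
  define Y where "Y = {y. norm y \<le> norm k} \<inter> {y. star y = y} \<inter> (\<Inter>z\<in>{z. z * k = k * z}. {y. z * y = y * z})"
  have Y_iff: "y \<in> Y \<longleftrightarrow> norm y \<le> norm k \<and> star y = y \<and> (\<forall>z. z * k = k * z \<longrightarrow> z * y = y * z)" for y
    by (simp add: Y_def)
  define f where "f y = (1/2) *\<^sub>R (k + y * y)" for y
  have "closed Y" unfolding Y_def
    by (intro closed_Int closed_INT ballI closed_Collect_le closed_Collect_eq continuous_intros)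
  then have Y: "complete Y" by (simp add: complete_eq_closed)
  have "0 \<in> Y" by (simp add: Y_iff)
  then have ne: "Y \<noteq> {}" by blast
  have "f y \<in> Y" if "y \<in> Y" for y
  proof -
    have y: "norm y \<le> norm k" "star y = y" and comm: "\<And>z. z * k = k * z \<Longrightarrow> z * y = y * z"
      using that unfolding Y_iff by blast+
    have "norm (y * y) \<le> norm k * 1"
      by (rule order_trans[OF norm_mult_ineq mult_mono]) (use y k in simp_all)
    then have "norm (k + y * y) \<le> 2 * norm k"
      by (intro norm_triangle_le) simp
    then have "norm (f y) \<le> norm k" by (simp add: f_def)
    moreover have "star (f y) = f y" using y k by (simp add: f_def star_scaleR star_add star_mult)
    moreover have "z * f y = f y * z" if z: "z * k = k * z" for z
    proof -
      have "z * (y * y) = y * y * z" using comm[OF z] by (metis mult.assoc)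
      with z show ?thesis by (simp add: f_def distrib_left distrib_right)
    qed
    ultimately show ?thesis unfolding Y_iff by blast
  qed
  then have maps: "f ` Y \<subseteq> Y" by blast
  have "dist (f y) (f y') \<le> norm k * dist y y'" if y: "y \<in> Y" "y' \<in> Y" for y y'
  proof -
    have "norm (y * (y - y')) \<le> norm k * norm (y - y')" "norm ((y - y') * y') \<le> norm (y - y') * norm k"
      by (rule order_trans[OF norm_mult_ineq mult_mono]; use y in \<open>simp add: Y_iff\<close>)+
    then have "norm (y * (y - y') + (y - y') * y') \<le> 2 * (norm k * norm (y - y'))"
      by (intro norm_triangle_le) (simp add: mult.commute)
    moreover have "f y - f y' = (1/2) *\<^sub>R (y * (y - y') + (y - y') * y')"
      by (simp add: f_def algebra_simps)
    ultimately show ?thesis by (simp add: dist_norm)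
  qed
  then obtain y where y: "y \<in> Y" "f y = y"
    using Banach_fix[OF Y ne norm_ge_zero k(2) maps] by blast
  have "2 *\<^sub>R f y = k + y * y" by (simp add: f_def)
  then have "y + y = k + y * y" by (simp add: y(2) scaleR_2)
  then have "(1 - y) * (1 - y) = 1 - k"
    by (simp add: algebra_simps)
  moreover have "star (1 - y) = 1 - y" using y(1) by (simp add: star_diff Y_iff)
  moreover have "z * (1 - y) = (1 - y) * z" if "z * k = k * z" for z
    using y(1) that unfolding Y_iff by (simp add: left_diff_distrib right_diff_distrib)
  ultimately show ?thesis by blast
qed

text \<open>The shift by \<open>e\<close> gives \<open>k = (t 1 - h) / (t + e)\<close> norm strictly
  below 1, and \<open>h + e 1 = (t + e) (1 - k)\<close>.\<close>

lemma pos_sqrt: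
  assumes h: "pos h" and e: "0 < e"
  shows "\<exists>r. star r = r \<and> r * r = h + e *\<^sub>R 1 \<and> (\<forall>z. z * h = h * z \<longrightarrow> z * r = r * z)"
proof -
  obtain t where t: "norm (t *\<^sub>R 1 - h) \<le> t" "0 \<le> t" "star h = h"
    using h by (auto simp: pos_def)
  define c where "c = t + e"
  have c: "c > 0" using t e by (simp add: c_def)
  define k where "k = (1/c) *\<^sub>R (t *\<^sub>R 1 - h)"
  have "norm k < 1" using t e c by (simp add: k_def c_def)
  have "star k = k" using t by (simp add: k_def star_scaleR star_diff)
  then obtain r where r: "star r = r" "r * r = 1 - k" "\<And>z. z * k = k * z \<Longrightarrow> z * r = r * z"
    using sqrt_one_minus[of k] \<open>norm k < 1\<close> by blast
  have "(sqrt c *\<^sub>R r) * (sqrt c *\<^sub>R r) = c *\<^sub>R (r * r)"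
    using c by simp
  also have "\<dots> = h + e *\<^sub>R 1"
    using c by (simp add: r(2) k_def scaleR_diff_right) (simp add: c_def scaleR_add_left)
  finally have "(sqrt c *\<^sub>R r) * (sqrt c *\<^sub>R r) = h + e *\<^sub>R 1" .
  moreover have "z * (sqrt c *\<^sub>R r) = (sqrt c *\<^sub>R r) * z" if "z * h = h * z" for z
    using r(3)[of z] that by (simp add: k_def algebra_simps)
  ultimately show ?thesis using r(1) by (intro exI[of _ "sqrt c *\<^sub>R r"]) (simp add: star_scaleR)
qed

text \<open>For commuting self-adjoint \<open>k\<close>, \<open>l\<close>, the element \<open>k + i l\<close> has real part \<open>k\<close> and
  absolute square \<open>k\<^sup>2 + l\<^sup>2\<close>.\<close>

lemma norm_square_le_norm_sum_squares:
  fixes k l :: "'b::unital_cstar_algebra"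
  assumes "star k = k" "star l = l" "k * l = l * k"
  shows "(norm k)\<^sup>2 \<le> norm (k * k + l * l)"
proof -
  define u where "u = k + \<i> *\<^sub>C l"
  have star_u: "star u = k - \<i> *\<^sub>C l"
    using assms by (simp add: u_def star_add star_scaleC)
  have "\<i> *\<^sub>C \<i> *\<^sub>C x = - x" for x :: 'b
    by (simp add: scaleC_scaleC)
  then have "star u * u = k * k + l * l"
    using assms(3) by (simp add: star_u) (simp add: u_def algebra_simps mult_scaleC_left mult_scaleC_right)
  moreover have "2 *\<^sub>R k = u + star u"
    by (simp add: star_u) (simp add: u_def scaleR_2)
  then have "norm (2 *\<^sub>R k) \<le> norm u + norm u"
    using norm_triangle_ineq[of u "star u"] by simp
  then have "norm k \<le> norm u" by simp
  ultimately show ?thesis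
    by (metis norm_ge_zero norm_star_mult power_mono)
qed

text \<open>For \<open>g = h / c\<close>, the root \<open>s\<close> of \<open>1 - g\<^sup>2\<close>
  commutes with \<open>g\<close>, and \<open>s\<^sup>2 + g\<^sup>2 = 1\<close> forces
  \<open>norm s \<le> 1\<close>.\<close>

lemma norm_diff_square_le:
  fixes h :: "'b::unital_cstar_algebra"
  assumes h: "star h = h" "norm h < c"
  shows "norm (c\<^sup>2 *\<^sub>R 1 - h * h) \<le> c\<^sup>2"
proof -
  have c: "c > 0" using h norm_ge_zero[of h] by linarith
  define g where "g = (1/c) *\<^sub>R h"
  have g: "star g = g" using h by (simp add: g_def star_scaleR)
  have "norm g < 1" using h c by (simp add: g_def)
  then have "norm (g * g) < 1"
    using g by (simp add: norm_self_adjoint_square abs_square_less_1)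
  have "star (g * g) = g * g" by (simp add: star_mult g)
  then obtain s where s: "star s = s" "s * s = 1 - g * g"
      and comm: "\<And>z. z * (g * g) = (g * g) * z \<Longrightarrow> z * s = s * z"
    using sqrt_one_minus[of "g * g"] \<open>norm (g * g) < 1\<close> by blast
  have "g * s = s * g" by (rule comm) (simp add: mult.assoc)
  have "(norm s)\<^sup>2 \<le> norm (s * s + g * g)"
    using norm_square_le_norm_sum_squares[of s g] s g \<open>g * s = s * g\<close> by simp
  then have "norm (1 - g * g) \<le> 1"
    using s norm_one_le[where 'b = 'b] by (simp flip: norm_self_adjoint_square)
  then have "norm (c\<^sup>2 *\<^sub>R (1 - g * g)) \<le> c\<^sup>2" using c by (simp add: mult_left_le)
  then show ?thesis using c by (simp add: g_def scaleR_diff_right power2_eq_square)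
qed

lemma pos_square: "star h = h \<Longrightarrow> pos (h * (h::'b::unital_cstar_algebra))"
  using norm_diff_square_le[of h "norm h + 1"] by (auto intro: posI simp: star_mult)

text \<open>Up to the small shift \<open>d\<close>, \<open>h\<close> is a square, for which
  \<open>norm_diff_square_le\<close> gives the bound; the slack \<open>e\<close> absorbs the shift.
  This frees \<open>pos\<close> from its existential witness.\<close>

lemma pos_norm_diff_le:
  fixes h :: "'b::unital_cstar_algebra"
  assumes h: "pos h" "norm h \<le> s"
  shows "norm (s *\<^sub>R 1 - h) \<le> s"
proof (rule field_le_epsilon)
  fix e :: real assume e: "0 < e"
  define d where "d = e / 3"
  have d: "d > 0" using e by (simp add: d_def)
  have s: "s \<ge> 0" using h norm_ge_zero[of h] by linarith
  obtain r where r: "star r = r" "r * r = h + d *\<^sub>R 1" "\<And>z. z * h = h * z \<Longrightarrow> z * r = r * z"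
    using pos_sqrt[OF h(1) d] by blast
  have d1: "norm (d *\<^sub>R (1::'b)) \<le> d" using d by (intro norm_scaleR_one_le) simp
  then have "norm (r * r) \<le> s + d"
    unfolding r(2) using norm_triangle_ineq[of h "d *\<^sub>R 1"] h(2) by linarith
  then have "(norm r)\<^sup>2 \<le> s + d" by (simp add: norm_self_adjoint_square r(1))
  then have "norm r < sqrt (s + 2 * d)"
    using d by (intro real_less_rsqrt) linarith
  from norm_diff_square_le[OF r(1) this] have "norm ((s + 2 * d) *\<^sub>R 1 - r * r) \<le> s + 2 * d"
    using s d by simp
  then have "norm ((s + 2 * d) *\<^sub>R 1 - r * r) + norm (d *\<^sub>R (1::'b)) \<le> s + e"
    using d1 d_def by linarith
  then have "norm ((s + 2 * d) *\<^sub>R 1 - r * r - d *\<^sub>R 1) \<le> s + e"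
    by (rule order_trans[OF norm_triangle_ineq4])
  moreover have "(s + 2 * d) *\<^sub>R 1 - r * r - d *\<^sub>R 1 = s *\<^sub>R 1 - h"
    unfolding r(2) by (simp add: scaleR_add_left) (simp flip: scaleR_diff_left)
  ultimately show "norm (s *\<^sub>R 1 - h) \<le> s + e" by simp
qed

text \<open>The witness in \<open>pos\<close> can be taken to be \<open>norm h\<close>, which leaves
  an inequality between continuous functions of \<open>h\<close>.\<close>

lemma closed_pos: "closed {h::'b::unital_cstar_algebra. pos h}"
proof -
  have "{h::'b. pos h} = {h. star h = h} \<inter> {h. norm (norm h *\<^sub>R 1 - h) \<le> norm h}"
    using pos_norm_diff_le pos_star posI by blast
  then show ?thesis
    by (simp only:) (intro closed_Int closed_Collect_le closed_Collect_eq continuous_intros)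
qed

text \<open>Up to shifts by \<open>d\<close>, \<open>h\<close> and \<open>s 1 - h\<close> are
  squares of commuting roots \<open>r\<close> and \<open>l\<close>, and these squares add up to
  \<open>(s + 2 d) 1\<close>.\<close>

lemma pos_norm_le:
  fixes h :: "'b::unital_cstar_algebra"
  assumes h: "pos h" "pos (s *\<^sub>R 1 - h)" "0 \<le> s"
  shows "norm h \<le> s"
proof (rule field_le_epsilon)
  fix e :: real assume e: "0 < e"
  define d where "d = e / 3"
  have d: "d > 0" using e by (simp add: d_def)
  obtain r where r: "star r = r" "r * r = h + d *\<^sub>R 1" "\<And>z. z * h = h * z \<Longrightarrow> z * r = r * z"
    using pos_sqrt[OF h(1) d] by blast
  obtain l where l: "star l = l" "l * l = s *\<^sub>R 1 - h + d *\<^sub>R 1"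
    "\<And>z. z * (s *\<^sub>R 1 - h) = (s *\<^sub>R 1 - h) * z \<Longrightarrow> z * l = l * z"
    using pos_sqrt[OF h(2) d] by blast
  have "h * l = l * h" using l(3)[of h] by (simp add: algebra_simps)
  then have "l * r = r * l" using r(3)[of l] by simp
  then have "(norm r)\<^sup>2 \<le> norm (r * r + l * l)"
    using norm_square_le_norm_sum_squares[of r l] r(1) l(1) by simp
  also have "r * r + l * l = (s + 2 * d) *\<^sub>R 1"
    unfolding r(2) l(2) by (simp add: scaleR_add_left flip: scaleR_2)
  also have "norm \<dots> \<le> s + 2 * d" using h(3) d by (intro norm_scaleR_one_le) simp
  finally have "norm (r * r) + norm (d *\<^sub>R (1::'b)) \<le> s + e"
    using norm_scaleR_one_le[where 'b = 'b, OF less_imp_le[OF d]] d_def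
    unfolding norm_self_adjoint_square[OF r(1)] by linarith
  then have "norm (r * r - d *\<^sub>R 1) \<le> s + e"
    by (rule order_trans[OF norm_triangle_ineq4])
  then show "norm h \<le> s + e" by (simp add: r(2))
qed

text \<open>With \<open>t = norm (h + k)\<close>, the element \<open>t 1 - h\<close> is the sum of
  the positive elements \<open>t 1 - (h + k)\<close> and \<open>k\<close>.\<close>

lemma norm_le_norm_add_pos:
  assumes "pos h" "pos k"
  shows "norm h \<le> norm (h + k)"
proof -
  have "pos (norm (h + k) *\<^sub>R 1 - (h + k))"
    using pos_norm_diff_le[OF pos_add[OF assms] order_refl] pos_add[OF assms]
    by (intro posI[of _ "norm (h + k)"]) (simp_all add: star_diff star_scaleR pos_star norm_scaleR_one_le add.commute)
  from pos_add[OF this assms(2)] show ?thesis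
    using assms(1) by (intro pos_norm_le) (simp_all add: algebra_simps)
qed

text \<open>After a shift by \<open>e\<close> both factors have self-adjoint roots \<open>r\<close>
  and \<open>l\<close> that commute, so the product is the square of \<open>r * l\<close>;
  closedness of positivity allows \<open>e\<close> to tend to 0.\<close>

lemma pos_mult:
  assumes h: "pos h" and k: "pos k" and comm: "h * k = k * h"
  shows "pos (h * k)"
proof -
  have "((\<lambda>e. (h + e *\<^sub>R 1) * (k + e *\<^sub>R 1)) \<longlongrightarrow> (h + 0 *\<^sub>R 1) * (k + 0 *\<^sub>R 1)) (at_right (0::real))"
    by (intro tendsto_intros)
  then have lim: "((\<lambda>e. (h + e *\<^sub>R 1) * (k + e *\<^sub>R 1)) \<longlongrightarrow> h * k) (at_right (0::real))"
    by simp
  have "(h + e *\<^sub>R 1) * (k + e *\<^sub>R 1) \<in> {h. pos h}" if e: "0 < e" for e :: real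
  proof -
    obtain r where r: "star r = r" "r * r = h + e *\<^sub>R 1" "\<And>z. z * h = h * z \<Longrightarrow> z * r = r * z"
      using pos_sqrt[OF h e] by blast
    obtain l where l: "star l = l" "l * l = k + e *\<^sub>R 1" "\<And>z. z * k = k * z \<Longrightarrow> z * l = l * z"
      using pos_sqrt[OF k e] by blast
    have "l * r = r * l" using comm l(3)[of h] r(3)[of l] by simp
    then have "star (r * l) = r * l" "(r * l) * (r * l) = (r * r) * (l * l)"
      using r(1) l(1) by (simp_all add: star_mult) (metis mult.assoc)
    then show ?thesis using pos_square[of "r * l"] r(2) l(2) by simp
  qed
  then have "\<forall>\<^sub>F e in at_right (0::real). (h + e *\<^sub>R 1) * (k + e *\<^sub>R 1) \<in> {h. pos h}"
    by (simp add: eventually_at_right_less eventually_mono[OF eventually_at_right_less])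
  from Lim_in_closed_set[OF closed_pos this _ lim] show ?thesis by simp
qed

lemma pos_power: "pos h \<Longrightarrow> pos (h ^ n)"
  by (induction n) (simp_all add: pos_one pos_mult power_commutes)

section \<open>Positivity of \<open>star x * x\<close>\<close>

lemma pos_one_minus: "star h = h \<Longrightarrow> norm h \<le> 1 \<Longrightarrow> pos (1 - (h::'b::unital_cstar_algebra))"
  by (rule posI[of _ 1]) (simp_all add: star_diff)

text \<open>With \<open>s = 1 - h \<ge> 0\<close>, the element is \<open>(s - 1) (s ^ n - 1) + s\<close>.\<close>

lemma pos_one_minus_mult_power:
  assumes h: "star h = h" "norm (h::'b::unital_cstar_algebra) \<le> 1"
  shows "pos (1 - h * (1 - h) ^ n)"
proof -
  define s where "s = 1 - h"
  have s: "pos s" using pos_one_minus[OF h] by (simp add: s_def)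
  \<comment> \<open>Only self-adjointness of \<open>h\<close> is available, so the next element is
    written as \<open>s (h - h s ^ n) + h\<^sup>2\<close>.\<close>
  have "pos (h - h * s ^ n)" for n
  proof (induction n)
    case (Suc n)
    have sh: "s * h = h * s" by (simp add: s_def algebra_simps)
    then have assoc: "s * (h * s ^ n) = h * s ^ Suc n" "h * s ^ n * s = h * s ^ Suc n"
      by (metis mult.assoc power_Suc, metis mult.assoc power_Suc2)
    have "s * (h - h * s ^ n) = (h - h * s ^ n) * s"
      by (simp only: right_diff_distrib left_diff_distrib sh assoc)
    then have "pos (s * (h - h * s ^ n) + h * h)"
      using Suc s pos_square[OF h(1)] by (intro pos_add[OF pos_mult])
    moreover have "s * (h - h * s ^ n) + h * h = h - h * s ^ Suc n"
      by (simp only: right_diff_distrib sh assoc) (simp add: s_def algebra_simps)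
    ultimately show ?case by simp
  qed (simp add: pos_zero)
  from pos_add[OF this s] show ?thesis by (simp add: s_def)
qed

text \<open>Up to sign, \<open>u\<close> and \<open>v\<close> are twice the real and imaginary parts
  of \<open>x\<close>, and the element is half the sum of their squares. Positivity of
  \<open>star x * x\<close> itself will be derived from this.\<close>

lemma pos_mult_star_add: "pos (x * star x + star x * (x::'b::unital_cstar_algebra))"
proof -
  define u v where "u = x + star x" and "v = \<i> *\<^sub>C (x - star x)"
  have "star u = u" by (simp add: u_def star_add star_star add.commute)
  moreover have "star v = v"
    by (simp add: v_def star_scaleC star_diff star_star flip: complex_vector.scale_minus_right)
  ultimately have "pos ((1/2) *\<^sub>R (u * u + v * v))"
    by (intro pos_scaleR pos_add pos_square) simp_all
  moreover have "v * v = - ((x - star x) * (x - star x))"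
    by (simp add: v_def mult_scaleC_left mult_scaleC_right scaleC_scaleC)
  then have "u * u + v * v = 2 *\<^sub>R (x * star x + star x * x)"
    by (simp add: u_def algebra_simps scaleR_2)
  ultimately show ?thesis by simp
qed

text \<open>For self-adjoint \<open>s\<close> the C*-identity makes the norm multiplicative on the
  powers \<open>2 ^ m\<close>, so a norm above 1 would grow exponentially along them.\<close>

lemma linear_growth_imp_norm_le_one:
  assumes s: "star s = s" and growth: "\<And>n. norm (s ^ n) \<le> 1 + C * real n"
  shows "norm (s::'b::unital_cstar_algebra) \<le> 1"
proof (rule ccontr)
  assume "\<not> norm s \<le> 1"
  then have d: "norm s - 1 > 0" by simp
  have pow: "norm (s ^ (2 ^ m)) = norm s ^ (2 ^ m)" for m
  proof (induction m)
    case (Suc m)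
    have "s ^ (2 ^ Suc m) = s ^ (2 ^ m) * s ^ (2 ^ m)"
      by (simp add: mult_2 power_add)
    moreover have "star (s ^ (2 ^ m)) = s ^ (2 ^ m)" by (simp add: star_power s)
    ultimately show ?case
      using Suc by (simp add: norm_self_adjoint_square flip: power_mult power_mult_distrib)
        (simp add: mult.commute)
  qed simp
  have C: "0 \<le> 1 + C" using order_trans[OF norm_ge_zero growth[of 1]] by simp
  \<comment> \<open>Bernoulli's inequality at \<open>n = 2 ^ m\<close>, squared, grows quadratically
    in \<open>n\<close>, whereas \<open>norm (s ^ (2 n))\<close> grows at most linearly; one factor
    \<open>n\<close> cancels.\<close>
  have bound: "2 ^ m * (norm s - 1)\<^sup>2 \<le> 3 + 2 * C" for m
  proof -
    let ?n = "2 ^ m :: nat"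
    have "(real ?n * (norm s - 1))\<^sup>2 \<le> (1 + real ?n * (norm s - 1))\<^sup>2"
      using d by (intro power_mono) simp_all
    also have "\<dots> \<le> (norm s ^ ?n)\<^sup>2"
      using Bernoulli_inequality[of "norm s - 1" ?n] d by (intro power_mono) simp_all
    also have "\<dots> = norm (s ^ (2 ^ Suc m))"
      by (simp only: pow) (simp flip: power_mult add: mult.commute)
    also have "\<dots> \<le> 1 + C * real (2 ^ Suc m)" by (rule growth)
    also have "\<dots> \<le> real ?n * (3 + 2 * C)"
      by (simp add: algebra_simps) (use one_le_power[of "2::real" m] in linarith)
    finally have "real ?n * (real ?n * (norm s - 1)\<^sup>2) \<le> real ?n * (3 + 2 * C)"
      by (simp add: power2_eq_square ac_simps)
    then show ?thesis by simp
  qed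
  obtain m :: nat where "(3 + 2 * C) / (norm s - 1)\<^sup>2 < real m"
    using reals_Archimedean2 by blast
  also have "real m < 2 ^ m" by (rule of_nat_less_two_power)
  finally have "3 + 2 * C < 2 ^ m * (norm s - 1)\<^sup>2"
    using d by (simp add: divide_simps)
  with bound[of m] show False by simp
qed

text \<open>
  With \<open>h = x\<^sup>* x\<close> and \<open>y = x (1 - h) ^ n\<close> one has \<open>y\<^sup>* y = h (1 - h) ^ (2 n)\<close> and
  \<open>y y\<^sup>* = k (1 - k) ^ (2 n)\<close> for \<open>k = x x\<^sup>*\<close>. Both are at most 1, and their sum is positive;
  hence they are bounded independently of \<open>n\<close>, which forces \<open>\<parallel>1 - h\<parallel> \<le> 1\<close>.
\<close>

lemma norm_one_minus_star_mult_le: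
  fixes x :: "'b::unital_cstar_algebra"
  assumes x: "norm x \<le> 1"
  shows "norm (1 - star x * x) \<le> 1"
proof -
  define h k s where "h = star x * x" and "k = x * star x" and "s = 1 - h"
  have sa: "star h = h" "star k = k" "star s = s"
    by (simp_all add: h_def k_def s_def star_mult star_star star_diff)
  have "(norm x)\<^sup>2 \<le> 1" using x by (simp add: abs_square_le_1)
  then have norms: "norm h \<le> 1" "norm k \<le> 1"
    using norm_star_mult[of x] norm_star_mult[of "star x"] by (simp_all add: h_def k_def star_star)
  have norm_s: "norm s \<le> 2"
    using norm_triangle_ineq4[of 1 h] norms norm_one_le[where 'b = 'b] by (simp add: s_def)
  have comm: "h * s ^ n = s ^ n * h" for n
    by (rule power_commuting_commutes[symmetric]) (simp add: s_def algebra_simps)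
  have swap: "x * s ^ n = (1 - k) ^ n * x" for n
  proof (induction n)
    case (Suc n)
    have "x * s = (1 - k) * x"
      by (simp add: s_def h_def k_def algebra_simps)
    then show ?case using Suc by (metis mult.assoc power_Suc power_Suc2)
  qed simp
  have even: "norm (h * s ^ (2 * n)) \<le> 3" for n
  proof -
    define y where "y = x * s ^ n"
    have sy: "star y = s ^ n * star x" by (simp add: y_def star_mult star_power sa)
    have "star y * y = s ^ n * h * s ^ n"
      unfolding sy unfolding y_def by (simp add: h_def mult.assoc)
    then have yy: "star y * y = h * s ^ (2 * n)"
      by (simp only: comm[symmetric] mult.assoc mult_2 power_add)
    have "y * star y = x * s ^ (2 * n) * star x"
      unfolding sy unfolding y_def by (simp add: mult.assoc mult_2 power_add)
    also have "\<dots> = (1 - k) ^ (2 * n) * k"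
      by (simp add: swap k_def mult.assoc)
    also have "\<dots> = k * (1 - k) ^ (2 * n)"
      by (induction n) (simp_all add: algebra_simps mult.assoc)
    finally have yy': "y * star y = k * (1 - k) ^ (2 * n)" .
    have 1: "pos (1 - star y * y)"
      unfolding yy s_def by (rule pos_one_minus_mult_power[OF sa(1) norms(1)])
    have 2: "pos (1 - y * star y)"
      unfolding yy' by (rule pos_one_minus_mult_power[OF sa(2) norms(2)])
    \<comment> \<open>The element is the sum of \<open>1 - y * star y\<close> and
      \<open>y * star y + star y * y\<close>; this is the lower bound for
      \<open>star y * y\<close>.\<close>
    have 3: "pos (1 + star y * y)"
      using pos_add[OF 2 pos_mult_star_add[of y]] by simp
    moreover have "pos (2 *\<^sub>R 1 - (1 + star y * y))"
      using 1 by (simp add: scaleR_2)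
    ultimately have "norm (1 + star y * y) \<le> 2"
      using pos_norm_le by fastforce
    then have "norm (1 + star y * y - 1) \<le> 3"
      using norm_triangle_ineq4[of "1 + star y * y" 1] norm_one_le[where 'b = 'b] by linarith
    then show ?thesis by (simp add: yy)
  qed
  have bounded: "norm (h * s ^ n) \<le> 6" for n
  proof (cases "even n")
    case True
    then obtain m where "n = 2 * m" by (rule evenE)
    then show ?thesis using even[of m] by simp
  next
    case False
    then obtain m where m: "n = Suc (2 * m)" by (metis oddE Suc_eq_plus1)
    have "h * s ^ n = h * s ^ (2 * m) * s" by (simp add: m mult.assoc power_commutes)
    then have "norm (h * s ^ n) \<le> 3 * 2"
      using norm_mult_ineq[of "h * s ^ (2 * m)" s] mult_mono[OF even[of m] norm_s] by simp
    then show ?thesis by simp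
  qed
  \<comment> \<open>Consecutive powers of \<open>s\<close> differ by \<open>h * s ^ n\<close>, so
    the uniform bound 6 adds up to linear growth.\<close>
  have "norm (s ^ n) \<le> 1 + 6 * real n" for n
  proof (induction n)
    case (Suc n)
    have "s ^ Suc n = s ^ n - h * s ^ n" by (simp add: s_def left_diff_distrib)
    then show ?case
      using Suc bounded[of n] norm_triangle_ineq4[of "s ^ n" "h * s ^ n"] by simp
  qed (simp add: norm_one_le[where 'b = 'b])
  then show ?thesis
    using linear_growth_imp_norm_le_one[OF sa(3), of 6] by (simp add: s_def h_def)
qed

lemma pos_star_mult: "pos (star x * (x::'b::unital_cstar_algebra))"
proof (cases "x = 0")
  case False
  define c where "c = norm x"
  have c: "c > 0" using False by (simp add: c_def)
  define y where "y = (1/c) *\<^sub>R x"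
  have "norm (1 - star y * y) \<le> 1"
    using c by (intro norm_one_minus_star_mult_le) (simp add: y_def c_def)
  then have "pos (star y * y)"
    by (intro posI[of _ 1]) (simp_all add: star_mult star_star)
  then have "pos (c\<^sup>2 *\<^sub>R (star y * y))"
    by (rule pos_scaleR) simp
  then show ?thesis using c by (simp add: y_def star_scaleR power2_eq_square)
qed (simp add: pos_zero)

text \<open>The inductive invariant \<open>1 - (1 - h) ^ n - n h (1 - h) ^ n \<ge> 0\<close> reflects that the summands of
  \<open>\<Sum>j<n. h (1 - h) ^ j = 1 - (1 - h) ^ n\<close> decrease.\<close>

lemma norm_mult_one_minus_power_le:
  assumes h: "pos h" "norm h \<le> 1"
  shows "real n * norm (h * (1 - h) ^ n) \<le> 1"
proof -
  define s where "s = 1 - h"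
  have s: "pos s" using pos_one_minus[OF pos_star[OF h(1)] h(2)] by (simp add: s_def)
  have comm: "h * s ^ n = s ^ n * h" for n
    by (rule power_commuting_commutes[symmetric]) (simp add: s_def algebra_simps)
  have pos: "pos (h * s ^ n)" for n
    using h(1) comm by (intro pos_mult pos_power[OF s]) simp_all
  have "pos (1 - s ^ n - real n *\<^sub>R (h * s ^ n))" for n
  proof (induction n)
    case (Suc n)
    have step: "s ^ Suc n = s ^ n - h * s ^ n"
      by (simp add: s_def left_diff_distrib)
    have "pos (h * (h * s ^ n))"
      by (rule pos_mult[OF h(1) pos]) (metis comm mult.assoc)
    \<comment> \<open>The invariant changes by exactly this positive element when \<open>n\<close>
      becomes \<open>Suc n\<close>.\<close>
    then have "pos (real (Suc n) *\<^sub>R (h * (h * s ^ n)))"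
      by (rule pos_scaleR) simp
    from pos_add[OF Suc this] show ?case
      unfolding step by (simp add: algebra_simps)
  qed (simp add: pos_zero)
  from pos_add[OF this[of n] pos_power[OF s, of n]] have "pos (1 *\<^sub>R 1 - real n *\<^sub>R (h * s ^ n))"
    by simp
  then have "norm (real n *\<^sub>R (h * s ^ n)) \<le> 1"
    using pos by (intro pos_norm_le pos_scaleR) simp_all
  then show ?thesis by (simp add: s_def)
qed


subsection \<open>Sums of squares in a C*-algebra\<close>

lemma pos_lmult_star_mult: "pos (lmult (star x * x))"
  by (simp add: lmult_simps pos_star_mult)

text \<open>Monotonicity of the norm is transported along \<open>lmult\<close>. The four squares
  match the four coordinates in \<open>closed_graph_sum\<close>.\<close>

lemma norm_le_norm_sum_squares:
  fixes x y z w :: "'a::cstar_algebra"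
  shows "(norm x)\<^sup>2 \<le> norm (star x * x + star y * y + star z * z + star w * w)"
proof -
  have "norm (lmult (star x * x)) \<le> norm (lmult (star x * x) + lmult (star y * y + star z * z + star w * w))"
    unfolding lmult_simps(1) by (intro norm_le_norm_add_pos pos_add pos_lmult_star_mult)
  then show ?thesis
    by (simp add: norm_lmult norm_star_mult add.assoc flip: lmult_simps(1))
qed

text \<open>For \<open>g = x\<^sup>* x + y\<^sup>* y\<close> of norm at most 1, \<open>(1 - g) ^ n x\<^sup>*\<close> tends to 0, since
  its square is at most \<open>g (1 - g) ^ (2 n)\<close>; and it agrees with \<open>x\<^sup>*\<close> modulo \<open>g 'a\<close>.\<close>

lemma star_mem_closed_subspace:
  fixes M :: "'a::cstar_algebra set"
  assumes M: "subspace M" "closed M" and mem: "\<And>v. (star x * x + star y * y) * v \<in> M"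
  shows "star x \<in> M"
proof (cases "star x * x + star y * y = 0")
  case True
  then have "x = 0" using norm_le_norm_sum_squares[of x y 0 0] by simp
  then show ?thesis using M by (simp add: subspace_0)
next
  case False
  define c where "c = norm (star x * x + star y * y)"
  have c: "c > 0" using False by (simp add: c_def)
  define g where "g = (1/c) *\<^sub>R (star x * x + star y * y)"
  \<comment> \<open>\<open>'a\<close> may lack a unit, so \<open>V n\<close> is built by iterating
    \<open>v - g * v\<close>; \<open>P n\<close> is the corresponding power in the multiplier
    algebra.\<close>
  define V where "V n = ((\<lambda>v. v - g * v) ^^ n) (star x)" for n
  define P where "P n = (1 - lmult g) ^ n" for n
  have pos_g: "pos (lmult g)"
    unfolding g_def lmult_simps(5) using c
    by (intro pos_scaleR) (simp_all only: lmult_simps(1) pos_add pos_lmult_star_mult zero_le_divide_1_iff less_imp_le)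
  have norm_g: "norm (lmult g) \<le> 1"
    using c by (simp add: norm_lmult g_def c_def)
  have V: "lmult (V n) = P n * lmult (star x)" for n
    by (induction n) (simp_all add: V_def P_def lmult_simps algebra_simps)
  \<comment> \<open>The factor \<open>c\<close> undoes the normalization of \<open>g\<close>; the 2
    comes from the exponent \<open>2 n\<close> of \<open>1 - g\<close>.\<close>
  have bound: "(norm (V n))\<^sup>2 \<le> (c / 2) / real n" if n: "n > 0" for n
  proof -
    have star_P: "star (P n) = P n"
      by (simp add: P_def star_power star_diff pos_star[OF pos_g])
    have comm: "P n * lmult g = lmult g * P n"
      unfolding P_def by (rule power_commuting_commutes) (simp add: algebra_simps)
    let ?X = "lmult x * P n" and ?Y = "lmult y * P n"
    have "(norm (V n))\<^sup>2 = norm (star ?X * ?X)"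
    proof -
      have "star ?X = lmult (V n)" by (simp add: V star_mult star_P lmult_simps)
      then have "norm ?X = norm (V n)" by (metis norm_lmult norm_star)
      then show ?thesis by (simp add: norm_star_mult)
    qed
    also have "\<dots> \<le> norm (star ?X * ?X + star ?Y * ?Y)"
      by (intro norm_le_norm_add_pos pos_star_mult)
    also have "star ?X * ?X + star ?Y * ?Y = P n * (c *\<^sub>R lmult g) * P n"
      using c by (simp add: g_def lmult_simps star_mult star_P distrib_left distrib_right mult.assoc)
    also have "\<dots> = c *\<^sub>R (lmult g * P (2 * n))"
      by (simp add: comm mult.assoc) (simp add: P_def mult_2 power_add)
    also have "norm \<dots> = c * norm (lmult g * P (2 * n))"
      using c by simp
    finally have "2 * real n * (norm (V n))\<^sup>2 \<le> 2 * real n * (c * norm (lmult g * P (2 * n)))"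
      by (rule mult_left_mono) simp
    also have "\<dots> = c * (real (2 * n) * norm (lmult g * P (2 * n)))" by simp
    also have "\<dots> \<le> c * 1"
      unfolding P_def using c by (intro mult_left_mono norm_mult_one_minus_power_le pos_g norm_g) simp_all
    finally show ?thesis using n by (simp add: field_simps)
  qed
  have "(\<lambda>n. (norm (V n))\<^sup>2) \<longlonglongrightarrow> 0"
    using bound by (intro Lim_null_comparison[OF _ lim_const_over_n[of "c / 2"]])
      (auto simp: eventually_at_top_dense intro!: exI[of _ 0])
  from tendsto_real_sqrt[OF this] have "V \<longlonglongrightarrow> 0"
    by (simp add: tendsto_norm_zero_iff)
  then have "(\<lambda>n. star x - V n) \<longlonglongrightarrow> star x - 0" by (intro tendsto_intros)
  moreover have "star x - V n \<in> M" for n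
  proof (induction n)
    case (Suc n)
    have "(star x - V n) + g * V n \<in> M"
      using Suc mem[of "V n"] M(1) unfolding g_def by (simp add: subspace_add subspace_scale)
    then show ?case by (simp add: V_def algebra_simps)
  qed (simp add: V_def subspace_0 M)
  ultimately show ?thesis
    using closed_sequentially[OF M(2)] by (metis diff_zero)
qed

text \<open>This is \<open>star_mem_closed_subspace\<close> for \<open>y = 0\<close>: all
  \<open>star x * x * v\<close> lie in the ideal.\<close>

lemma closed_ideal_star:
  assumes K: "closed_ideal K" and x: "x \<in> K"
  shows "star x \<in> K"
proof (rule star_mem_closed_subspace)
  show "subspace K" "closed K"
    using K by (simp_all add: closed_ideal_def csubspace_imp_subspace)
  show "(star x * x + star 0 * 0) * v \<in> K" for v
    using K x by (simp add: closed_ideal_def)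
qed

text \<open>The left annihilator \<open>J\<close> of \<open>K\<close> is a closed ideal. It meets
  \<open>K\<close> only in 0, since \<open>x\<close> in both satisfies
  \<open>x * star x = 0\<close>; so essentiality forces \<open>J = {0}\<close>.\<close>

lemma essential_ideal_annihilator:
  fixes K :: "'a::cstar_algebra set"
  assumes K: "essential_ideal K" and z: "\<And>k. k \<in> K \<Longrightarrow> z * k = 0"
  shows "z = 0"
proof -
  define J where "J = {z. \<forall>k\<in>K. z * k = 0}"
  have ideal: "closed_ideal K" using K by (simp add: essential_ideal_def)
  have "J = (\<Inter>k\<in>K. {z. z * k = 0})" by (auto simp: J_def)
  then have "closed J"
    by (auto intro!: closed_INT closed_Collect_eq continuous_intros)
  moreover have "csubspace J"
    by (auto simp: J_def complex_vector.subspace_def distrib_right mult_scaleC_left)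
  ultimately have "closed_ideal J"
    using ideal by (auto simp: closed_ideal_def J_def mult.assoc)
  moreover have "K \<inter> J = {0}"
  proof -
    have "x = 0" if "x \<in> K" "x \<in> J" for x
    proof -
      have "x * star x = 0" using that closed_ideal_star[OF ideal] by (simp add: J_def)
      then show ?thesis by (simp add: mult_star_eq_0_iff)
    qed
    moreover have "0 \<in> K \<inter> J"
      using ideal by (simp add: J_def closed_ideal_def complex_vector.subspace_0)
    ultimately show ?thesis by blast
  qed
  ultimately have "J = {0}" using K by (auto simp: essential_ideal_def)
  with z show ?thesis by (auto simp: J_def)
qed


subsection \<open>Adjoints\<close>

lemma adjoint_onD: "(a, b) \<in> adjoint_on B T \<Longrightarrow> (x, y) \<in> T \<Longrightarrow> star a * y = star b * x"
  by (auto simp: adjoint_on_def)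

lemma adjoint_onD': "(a, b) \<in> adjoint_on B T \<Longrightarrow> (x, y) \<in> T \<Longrightarrow> star y * a = star x * b"
  using arg_cong[OF adjoint_onD, of a b B T x y star] by (simp add: star_mult star_star)

lemma mem_adjoint_on_UNIV_iff:
  "(a, b) \<in> adjoint_on UNIV T \<longleftrightarrow> (\<forall>x y. (x, y) \<in> T \<longrightarrow> star a * y = star b * x)"
  by (auto simp: adjoint_on_def)

lemma subset_adjoint_adjoint: "T \<subseteq> adjoint_on UNIV (adjoint_on UNIV T)"
proof clarify
  fix a b assume "(a, b) \<in> T"
  then show "(a, b) \<in> adjoint_on UNIV (adjoint_on UNIV T)"
    by (subst mem_adjoint_on_UNIV_iff) (blast dest: adjoint_onD' intro: sym)
qed

lemma adjoint_on_mult_right: "(a, b) \<in> adjoint_on UNIV T \<Longrightarrow> (a * x, b * x) \<in> adjoint_on UNIV T"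
  by (simp add: mem_adjoint_on_UNIV_iff star_mult mult.assoc)

lemma subspace_adjoint_on: "subspace (adjoint_on UNIV (T :: ('a::cstar_algebra \<times> 'a) set))"
  by (auto simp: subspace_def mem_adjoint_on_UNIV_iff zero_prod_def star_add star_scaleR distrib_right)

lemma closed_adjoint_on: "closed (adjoint_on UNIV (T :: ('a::cstar_algebra \<times> 'a) set))"
proof -
  have "adjoint_on UNIV T = (\<Inter>t\<in>T. {p. star (fst p) * snd t = star (snd p) * fst t})"
    by (fastforce simp: mem_adjoint_on_UNIV_iff)
  then show ?thesis
    by (auto intro!: closed_INT closed_Collect_eq continuous_intros)
qed

lemma operator_on_adjoint_on:
  assumes "dense_in UNIV (Domain T)"
  shows "operator_on UNIV (adjoint_on UNIV T)"
  using single_valued_adjoint_on[OF complex_vector.subspace_UNIV assms]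
  by (auto simp: operator_on_def mem_adjoint_on_UNIV_iff star_add star_scaleC distrib_right mult_scaleC_left)

text \<open>Semiregularity provides some value \<open>c\<close> of \<open>S\<close> at
  \<open>a * x\<close>; \<open>c\<close> and \<open>b * x\<close> have the same inner products with
  the dense domain of the adjoint.\<close>

lemma semiregular_mult_right:
  assumes S: "semiregular_on UNIV S" and ab: "(a, b) \<in> S"
  shows "(a * x, b * x) \<in> S"
proof -
  obtain c where c: "(a * x, c) \<in> S"
    using S ab by (force simp: semiregular_on_def)
  have "Domain (adjoint_on UNIV S) \<subseteq> {d. star d * (c - b * x) = 0}"
  proof clarsimp
    fix d e assume de: "(d, e) \<in> adjoint_on UNIV S"
    have "star d * c = star d * b * x"
      using adjoint_onD[OF de ab] adjoint_onD[OF de c] by (simp add: mult.assoc)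
    then show "star d * (c - b * x) = 0" by (simp add: right_diff_distrib mult.assoc)
  qed
  moreover have "closed {d. star d * (c - b * x) = 0}"
    by (intro closed_Collect_eq continuous_intros)
  ultimately have "UNIV \<subseteq> {d. star d * (c - b * x) = 0}"
    using S closure_minimal unfolding semiregular_on_def dense_in_def by blast
  then have "c - b * x = 0" using star_mult_eq_0_iff[of "c - b * x"] by blast
  with c show ?thesis by simp
qed

text \<open>Multiplying a point of \<open>S\<close> by \<open>k\<close> in \<open>K\<close> moves it
  into the restriction; essentiality then cancels \<open>k\<close>.\<close>

lemma adjoint_on_restrict_operator_subset:
  assumes K: "essential_ideal K" and S: "semiregular_on UNIV S"
  shows "adjoint_on K (restrict_operator S K) \<subseteq> adjoint_on UNIV S"
proof clarify
  fix y y' assume adj: "(y, y') \<in> adjoint_on K (restrict_operator S K)"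
  have "star y * b - star y' * a = 0" if ab: "(a, b) \<in> S" for a b
  proof (rule essential_ideal_annihilator[OF K])
    fix k assume "k \<in> K"
    then have "a * k \<in> K" using K by (auto simp: essential_ideal_def closed_ideal_def)
    then have "(a * k, b * k) \<in> restrict_operator S K"
      using semiregular_mult_right[OF S ab] by (simp add: restrict_operator_def)
    from adjoint_onD[OF adj this] show "(star y * b - star y' * a) * k = 0"
      by (simp add: left_diff_distrib mult.assoc)
  qed
  then show "(y, y') \<in> adjoint_on UNIV S" by (auto simp: adjoint_on_def)
qed


subsection \<open>The range of \<open>I + T\<^sup>* T\<^sup>*\<^sup>*\<close>\<close>

definition graph_sum :: "('a::cstar_algebra \<times> 'a) set \<Rightarrow> ('a \<times> 'a) set" where
  "graph_sum T = (\<lambda>((y, z), (w, w')). (y + w', z - w)) `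
     (adjoint_on UNIV (adjoint_on UNIV T) \<times> adjoint_on UNIV T)"

lemma graph_sumI:
  "(y, z) \<in> adjoint_on UNIV (adjoint_on UNIV T) \<Longrightarrow> (w, w') \<in> adjoint_on UNIV T \<Longrightarrow>
    (y + w', z - w) \<in> graph_sum T"
  unfolding graph_sum_def by (rule image_eqI[of _ _ "((y, z), (w, w'))"]) simp_all

lemma graph_sumE:
  assumes "p \<in> graph_sum T"
  obtains y z w w' where "p = (y + w', z - w)"
    "(y, z) \<in> adjoint_on UNIV (adjoint_on UNIV T)" "(w, w') \<in> adjoint_on UNIV T"
  using assms unfolding graph_sum_def by clarsimp

text \<open>The two summands are orthogonal, so their sum is complete.\<close>

lemma closed_graph_sum: "closed (graph_sum (T :: ('a::cstar_algebra \<times> 'a) set))"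
proof -
  define A where "A = adjoint_on UNIV T"
  define B where "B = adjoint_on UNIV A"
  define f :: "('a \<times> 'a) \<times> ('a \<times> 'a) \<Rightarrow> 'a \<times> 'a"
    where "f p = (fst (fst p) + snd (snd p), snd (fst p) - fst (snd p))" for p
  have "graph_sum T = f ` (B \<times> A)"
    unfolding graph_sum_def A_def[symmetric] B_def[symmetric] by (simp add: f_def[abs_def] split_def)
  moreover have "complete (f ` (B \<times> A))"
  \<comment> \<open>Each of the four coordinates has squared norm at most \<open>norm ?s\<close>, so
    the quadruple has squared norm at most 4 times that, whence \<open>1/2\<close>.\<close>
  proof (rule complete_isometric_image[of "1/2"])
    show "subspace (B \<times> A)"
      unfolding A_def B_def by (intro subspace_Times subspace_adjoint_on)
    show "bounded_linear f"
      unfolding f_def by (intro bounded_linear_Pair bounded_linear_add bounded_linear_sub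
          bounded_linear_fst_comp bounded_linear_snd_comp bounded_linear_ident)
    show "complete (B \<times> A)"
      unfolding A_def B_def by (simp add: complete_eq_closed closed_Times closed_adjoint_on)
    show "\<forall>p\<in>B \<times> A. 1 / 2 * norm p \<le> norm (f p)"
    proof clarify
      fix y z w w' assume yz: "(y, z) \<in> B" and ww: "(w, w') \<in> A"
      let ?u = "y + w'" and ?v = "z - w"
      let ?s = "star y * y + star z * z + star w * w + star w' * w'"
      have "star y * w' = star z * w" "star w' * y = star w * z"
        using adjoint_onD[OF yz[unfolded B_def] ww] adjoint_onD'[OF yz[unfolded B_def] ww] by simp_all
      then have sum: "star ?u * ?u + star ?v * ?v = ?s"
        by (simp add: star_add star_diff algebra_simps)
      have "norm ?s \<le> (norm ?u)\<^sup>2 + (norm ?v)\<^sup>2"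
        unfolding sum[symmetric] by (intro norm_triangle_le) (simp add: norm_star_mult)
      also have "\<dots> = (norm (f ((y, z), w, w')))\<^sup>2"
        by (simp add: f_def norm_Pair)
      finally have s: "norm ?s \<le> (norm (f ((y, z), w, w')))\<^sup>2" .
      have "(norm y)\<^sup>2 \<le> norm ?s" "(norm z)\<^sup>2 \<le> norm ?s" "(norm w)\<^sup>2 \<le> norm ?s" "(norm w')\<^sup>2 \<le> norm ?s"
        using norm_le_norm_sum_squares[of y z w w'] norm_le_norm_sum_squares[of z y w w']
          norm_le_norm_sum_squares[of w y z w'] norm_le_norm_sum_squares[of w' y z w]
        by (simp_all add: ac_simps)
      then have "(norm ((y, z), w, w'))\<^sup>2 \<le> 4 * norm ?s"
        by (simp add: norm_Pair)
      with s have "(1 / 2 * norm ((y, z), w, w'))\<^sup>2 \<le> (norm (f ((y, z), w, w')))\<^sup>2"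
        by (simp add: power_mult_distrib power2_eq_square)
      then show "1 / 2 * norm ((y, z), w, w') \<le> norm (f ((y, z), w, w'))"
        by (rule power2_le_imp_le) simp
    qed
  qed simp
  ultimately show ?thesis by (simp add: complete_eq_closed)
qed

lemma subspace_graph_sum: "subspace (graph_sum (T :: ('a::cstar_algebra \<times> 'a) set))"
proof -
  let ?A = "adjoint_on UNIV T" and ?B = "adjoint_on UNIV (adjoint_on UNIV T)"
  show ?thesis unfolding subspace_def
  proof (intro conjI ballI allI)
    have "(0, 0) \<in> ?A" "(0, 0) \<in> ?B"
      using subspace_0[OF subspace_adjoint_on] by (simp_all add: zero_prod_def)
    from graph_sumI[OF this(2,1)] show "0 \<in> graph_sum T" by (simp add: zero_prod_def)
  next
    fix p q assume "p \<in> graph_sum T" "q \<in> graph_sum T"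
    then obtain y z w w' y1 z1 w1 w1' where
        p: "p = (y + w', z - w)" "(y, z) \<in> ?B" "(w, w') \<in> ?A" and
        q: "q = (y1 + w1', z1 - w1)" "(y1, z1) \<in> ?B" "(w1, w1') \<in> ?A"
      by (elim graph_sumE)
    from graph_sumI[OF subspace_add[OF subspace_adjoint_on p(2) q(2), unfolded add_Pair]
        subspace_add[OF subspace_adjoint_on p(3) q(3), unfolded add_Pair]]
    show "p + q \<in> graph_sum T" by (simp add: p(1) q(1) algebra_simps)
  next
    fix r :: real and p assume "p \<in> graph_sum T"
    then obtain y z w w' where
        p: "p = (y + w', z - w)" "(y, z) \<in> ?B" "(w, w') \<in> ?A"
      by (elim graph_sumE)
    from graph_sumI[OF subspace_scale[OF subspace_adjoint_on p(2), of r, unfolded scaleR_Pair]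
        subspace_scale[OF subspace_adjoint_on p(3), of r, unfolded scaleR_Pair]]
    show "r *\<^sub>R p \<in> graph_sum T" by (simp add: p(1) algebra_simps)
  qed
qed

text \<open>The second coordinate 0 forces \<open>z = w\<close> in \<open>graph_sum\<close>, so
  \<open>u\<close> is \<open>y\<close> plus the adjoint applied to \<open>z\<close>. In this form
  closedness is inherited from \<open>graph_sum\<close>.\<close>

definition resolvent_range :: "('a::cstar_algebra \<times> 'a) set \<Rightarrow> 'a set" where
  "resolvent_range T = {u. (u, 0) \<in> graph_sum T}"

lemma closed_resolvent_range: "closed (resolvent_range T)"
proof -
  have "resolvent_range T = (\<lambda>u. (u, 0)) -` graph_sum T" by (auto simp: resolvent_range_def)
  then show ?thesis by (auto intro!: closed_vimage closed_graph_sum continuous_intros)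
qed

lemma subspace_resolvent_range: "subspace (resolvent_range T)"
proof (rule subspaceI)
  note N = subspace_graph_sum[of T]
  show "0 \<in> resolvent_range T"
    using subspace_0[OF N] by (simp add: resolvent_range_def zero_prod_def)
  show "u + v \<in> resolvent_range T" if "u \<in> resolvent_range T" "v \<in> resolvent_range T" for u v
    using subspace_add[OF N, of "(u, 0)" "(v, 0)"] that by (simp add: resolvent_range_def)
  show "r *\<^sub>R u \<in> resolvent_range T" if "u \<in> resolvent_range T" for r u
    using subspace_scale[OF N, of "(u, 0)" r] that by (simp add: resolvent_range_def)
qed

lemma resolvent_rangeE:
  assumes "u \<in> resolvent_range T"
  obtains y z w where "(y, z) \<in> adjoint_on UNIV (adjoint_on UNIV T)" "(z, w) \<in> adjoint_on UNIV T" "u = y + w"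
proof -
  from assms have "(u, 0) \<in> graph_sum T" by (simp add: resolvent_range_def)
  then obtain y z w w' where "(u, 0) = (y + w', z - w)"
    "(y, z) \<in> adjoint_on UNIV (adjoint_on UNIV T)" "(w, w') \<in> adjoint_on UNIV T"
    by (rule graph_sumE)
  then show thesis by (intro that[of y w w']) simp_all
qed

text \<open>The restriction lies in the double adjoint of \<open>S\<close> and its adjoint in that
  of \<open>S\<close>, so its range, dense in \<open>K\<close>, lies in a closed set.\<close>

lemma ideal_subset_resolvent_range:
  assumes K: "essential_ideal K" and S: "semiregular_on UNIV S"
    and reg: "regular_on K (restrict_operator S K)"
  shows "K \<subseteq> resolvent_range S"
proof -
  let ?T = "restrict_operator S K"
  have "{x + z | x z. (x, z) \<in> ?T O adjoint_on K ?T} \<subseteq> resolvent_range S"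
  proof clarify
    fix x y z assume xy: "(x, y) \<in> ?T" and yz: "(y, z) \<in> adjoint_on K ?T"
    have xy': "(x, y) \<in> adjoint_on UNIV (adjoint_on UNIV S)"
      using xy subset_adjoint_adjoint[of S] by (auto simp: restrict_operator_def)
    have "(y, z) \<in> adjoint_on UNIV S"
      using yz adjoint_on_restrict_operator_subset[OF K S] by blast
    from graph_sumI[OF xy' this] show "x + z \<in> resolvent_range S"
      by (simp add: resolvent_range_def)
  qed
  from closure_minimal[OF this closed_resolvent_range] show ?thesis
    using reg unfolding regular_on_def dense_in_def by (elim conjE) (rule order_trans)
qed

lemma central_mult_mem_resolvent_range:
  fixes S :: "('a::cstar_algebra \<times> 'a) set"
  assumes K: "closed_ideal K" and S: "semiregular_on UNIV S"
    and sub: "K \<subseteq> resolvent_range S" and ab: "(a, b) \<in> S"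
    and central: "\<And>x. a * x - x * a \<in> K"
  shows "a * v \<in> resolvent_range S"
proof -
  let ?N = "resolvent_range S"
  have central': "x * star a - star a * x \<in> K" for x
    using closed_ideal_star[OF K central[of "star x"]] by (simp add: star_diff star_mult star_star)
  have gram: "(star a * a + star b * b) * x \<in> ?N" for x
  proof -
    let ?p = "((star a * a + star b * b) * x, 0 :: 'a)"
    have "?p \<in> closure (graph_sum S)"
      unfolding closure_approachable
    proof (intro allI impI)
      fix e :: real assume e: "e > 0"
      define d where "d = e / (norm b + norm a + 1)"
      have pos: "norm b + norm a + 1 > 0" by (simp add: add_nonneg_pos)
      then have d: "d > 0" using e by (simp add: d_def)
      \<comment> \<open>\<open>b * x\<close> need not lie in the domain of the adjoint;
        \<open>w\<close> replaces it, and \<open>d\<close> is chosen to control both resulting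
        errors.\<close>
      have "b * x \<in> closure (Domain (adjoint_on UNIV S))"
        using S by (auto simp: semiregular_on_def dense_in_def)
      then obtain w w' where w: "(w, w') \<in> adjoint_on UNIV S" "dist w (b * x) < d"
        using d unfolding closure_approachable by blast
      have dom: "(a * x * star a, b * x * star a) \<in> adjoint_on UNIV (adjoint_on UNIV S)"
        using subset_adjoint_adjoint[of S] semiregular_mult_right[OF S semiregular_mult_right[OF S ab]]
        by blast
      define u where "u = (a * x + w') * star a"
      \<comment> \<open>A commutator with \<open>star a\<close>, hence in \<open>K\<close>.
        Subtracting \<open>(k, 0)\<close> moves \<open>star a\<close> to the left of
        \<open>a * x + w'\<close> without leaving \<open>graph_sum S\<close>, and there
        \<open>star a * w' = star b * w\<close>.\<close>
      define k where "k = u - star a * (a * x + w')"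
      have "(u, (b * x - w) * star a) \<in> graph_sum S"
        using graph_sumI[OF dom adjoint_on_mult_right[OF w(1), of "star a"]]
        by (simp add: u_def distrib_right left_diff_distrib)
      moreover have "(k, 0) \<in> graph_sum S"
        using central'[of "a * x + w'"] sub by (auto simp: k_def u_def resolvent_range_def)
      ultimately have "(u, (b * x - w) * star a) - (k, 0) \<in> graph_sum S"
        by (rule subspace_diff[OF subspace_graph_sum])
      moreover have "u - k = (star a * a + star b * b) * x + star b * (w - b * x)"
        using adjoint_onD'[OF w(1) ab]
        by (simp add: k_def distrib_left distrib_right right_diff_distrib mult.assoc)
      ultimately have mem: "((star a * a + star b * b) * x + star b * (w - b * x), (b * x - w) * star a) \<in> graph_sum S"
        by simp
      have "norm (star b * (w - b * x)) \<le> norm b * d" "norm ((b * x - w) * star a) \<le> d * norm a"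
        by (rule order_trans[OF norm_mult_ineq mult_mono]; use w(2) d in \<open>simp add: dist_norm norm_minus_commute\<close>)+
      then have "dist ((star a * a + star b * b) * x + star b * (w - b * x), (b * x - w) * star a) ?p
          \<le> norm b * d + d * norm a"
        by (simp add: dist_norm norm_Pair) (smt (verit) sqrt_sum_squares_le_sum norm_ge_zero)
      also have "\<dots> < (norm b + norm a + 1) * d"
        using d by (simp add: algebra_simps)
      also have "\<dots> = e" using pos by (simp add: d_def)
      finally show "\<exists>y\<in>graph_sum S. dist y ?p < e" using mem by blast
    qed
    then show ?thesis by (simp add: resolvent_range_def closed_graph_sum)
  qed
  note N = subspace_resolvent_range[of S] closed_resolvent_range[of S]
  have right: "u * x \<in> ?N" if "u \<in> ?N" for u x
  proof -
    from that obtain y z w where u: "(y, z) \<in> adjoint_on UNIV (adjoint_on UNIV S)"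
      "(z, w) \<in> adjoint_on UNIV S" "u = y + w"
      by (rule resolvent_rangeE)
    from graph_sumI[OF adjoint_on_mult_right[OF u(1), of x] adjoint_on_mult_right[OF u(2), of x]]
    show ?thesis by (simp add: resolvent_range_def u(3) distrib_right)
  qed
  have "star a \<in> ?N" by (rule star_mem_closed_subspace[OF N gram])
  \<comment> \<open>The same lemma is applied to \<open>star a\<close> with \<open>y = 0\<close>.
    Modulo \<open>K\<close>, \<open>a * star a\<close> equals \<open>star a * a\<close>, which lies
    in the right ideal \<open>?N\<close> because \<open>star a\<close> does.\<close>
  have "(star (star a) * star a + star 0 * 0) * x \<in> ?N" for x
  proof -
    have "star a * a * x + (a * star a - star a * a) * x \<in> ?N"
      using right[OF \<open>star a \<in> ?N\<close>, of "a * x"] right[of "a * star a - star a * a" x] central'[of a] sub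
      by (intro subspace_add[OF N(1)]) (auto simp: mult.assoc)
    then show ?thesis by (simp add: star_star algebra_simps)
  qed
  then have "star (star a) \<in> ?N" by (rule star_mem_closed_subspace[OF N])
  then show ?thesis by (simp add: right star_star)
qed

section \<open>Lifting totality from the quotient\<close>

lemma quot_span_subset_image:
  fixes K :: "'a::cstar_algebra set"
  assumes K: "closed_ideal K" and M: "subspace M"
    and G: "\<And>X c. X \<in> G \<Longrightarrow> quot_scaleC K c X \<in> quot_proj K ` M"
    and Y: "Y \<in> quot_span K G"
  shows "Y \<in> quot_proj K ` M"
  using Y
proof induction
  case zero
  then show ?case using M by (auto simp: subspace_0)
next
  case (add_scaleC X Y c)
  then obtain m n where "m \<in> M" "n \<in> M" "quot_scaleC K c X = quot_proj K m" "Y = quot_proj K n"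
    using G by blast
  then show ?case
    using M by (auto simp: quot_add_proj[OF K] subspace_add)
qed

text \<open>An approximation modulo \<open>K\<close> is corrected by an element of \<open>K\<close>,
  which \<open>M\<close> contains; so density in the quotient lifts to density of
  \<open>M\<close>.\<close>

lemma quot_total_imp_eq_UNIV:
  fixes K :: "'a::cstar_algebra set"
  assumes K: "closed_ideal K" and M: "subspace M" "closed M" "K \<subseteq> M"
    and G: "\<And>X c. X \<in> G \<Longrightarrow> quot_scaleC K c X \<in> quot_proj K ` M"
    and total: "quot_total K G"
  shows "M = UNIV"
proof -
  have "v \<in> closure M" for v
    unfolding closure_approachable
  proof (intro allI impI)
    fix e :: real assume "e > 0"
    then obtain Y where Y: "Y \<in> quot_span K G" "quot_norm (quot_diff K (quot_proj K v) Y) < e"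
      using total rangeI[of "quot_proj K" v] unfolding quot_total_def by blast
    then obtain m where m: "m \<in> M" "Y = quot_proj K m"
      using quot_span_subset_image[OF K M(1) G Y(1)] by blast
    have "(INF x\<in>quot_proj K (v - m). norm x) < e"
      using Y(2) by (simp add: m(2) quot_diff_proj[OF K] quot_norm_def)
    then obtain x where x: "x \<in> quot_proj K (v - m)" "norm x < e"
      using cInf_lessD[of "norm ` quot_proj K (v - m)" e] quot_proj_self[OF K, of "v - m"] by blast
    have "x - (v - m) \<in> M" using quot_proj_mem[OF K x(1)] M(3) by blast
    then have "m - (x - (v - m)) \<in> M" by (rule subspace_diff[OF M(1) m(1)])
    moreover have "dist (m - (x - (v - m))) v = norm x"
      by (simp add: dist_norm)
    ultimately show "\<exists>y\<in>M. dist y v < e" using x(2) by metis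
  qed
  then show ?thesis using M(2) by auto
qed

theorem theorem3p1:
  fixes K :: "'a::cstar_algebra set" and S :: "('a \<times> 'a) set"
  assumes "separable_space (euclidean :: 'a topology)"
    and "\<not> unital_algebra TYPE('a)"
    and "essential_ideal K"
    and "closed S" and "semiregular_on UNIV S"
    and "regular_on K (restrict_operator S K)"
    and "quot_total K {quot_mult K X Y | X Y.
           X \<in> quot_centre K \<inter> quot_proj K ` Domain S \<and> Y \<in> range (quot_proj K)}"
  shows "regular_on UNIV (adjoint_on UNIV (adjoint_on UNIV S))"
proof -
  let ?A = "adjoint_on UNIV S" and ?B = "adjoint_on UNIV (adjoint_on UNIV S)"
  note S = assms(5)
  have K: "closed_ideal K" using assms(3) by (simp add: essential_ideal_def)
  note sub = ideal_subset_resolvent_range[OF assms(3,5,6)]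
  have "resolvent_range S = UNIV"
  proof (rule quot_total_imp_eq_UNIV[OF K subspace_resolvent_range closed_resolvent_range sub _ assms(7)])
    fix X c assume "X \<in> {quot_mult K X Y | X Y.
           X \<in> quot_centre K \<inter> quot_proj K ` Domain S \<and> Y \<in> range (quot_proj K)}"
    then obtain a b v where ab: "(a, b) \<in> S" and a: "quot_proj K a \<in> quot_centre K"
        and X: "X = quot_mult K (quot_proj K a) (quot_proj K v)"
      by blast
    have "a * x - x * a \<in> K" for x
      using a by (auto simp: quot_centre_def quot_mult_proj[OF K] quot_proj_eq_iff[OF K])
    \<comment> \<open>Putting the scalar on \<open>v\<close> covers all complex multiples, although
      \<open>resolvent_range S\<close> is treated as a real subspace.\<close>
    then have "a * c *\<^sub>C v \<in> resolvent_range S"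
      by (rule central_mult_mem_resolvent_range[OF K S sub ab])
    then show "quot_scaleC K c X \<in> quot_proj K ` resolvent_range S"
      by (simp add: X quot_mult_proj[OF K] quot_scaleC_proj[OF K] mult_scaleC_right)
  qed
  then have "x \<in> {x + z | x z. (x, z) \<in> ?B O adjoint_on UNIV ?B}" for x
  proof -
    have "x \<in> resolvent_range S" using \<open>resolvent_range S = UNIV\<close> by simp
    then obtain y z w where "(y, z) \<in> ?B" "(z, w) \<in> ?A" "x = y + w"
      by (rule resolvent_rangeE)
    \<comment> \<open>\<open>z\<close> is in the domain of \<open>?A\<close>, while regularity of
      \<open>?B\<close> refers to the adjoint of \<open>?B\<close>; the latter extends
      \<open>?A\<close>.\<close>
    then show ?thesis using subset_adjoint_adjoint[of ?A] by blast
  qed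
  then have "{x + z | x z. (x, z) \<in> ?B O adjoint_on UNIV ?B} = UNIV" by blast
  then have "dense_in UNIV {x + z | x z. (x, z) \<in> ?B O adjoint_on UNIV ?B}"
    by (simp only: dense_in_def) simp
  moreover have dense: "dense_in UNIV D'" if "dense_in UNIV D" "D \<subseteq> D'" for D D' :: "'a set"
    using that closure_mono[OF that(2)] by (auto simp: dense_in_def)
  have "dense_in UNIV (Domain ?B)" "dense_in UNIV (Domain (adjoint_on UNIV ?B))"
    using S by (auto simp: semiregular_on_def intro: dense[OF _ Domain_mono[OF subset_adjoint_adjoint]])
  moreover have "operator_on UNIV ?B"
    using S by (intro operator_on_adjoint_on) (simp add: semiregular_on_def)
  ultimately show ?thesis
    by (simp add: regular_on_def closed_adjoint_on)
qed

end
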